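(* For every integer $t\ge 2$, $$r\!\left(K_{n,n},K_{2t,t(t-1)},\,2t^2(t-1)-t(t-1)+1\right)=\Omega\!\left(n^{1+\frac{1}{2t-3}}\right).$$
   Context: For graphs $G,H$ and an integer $q$ with $2\le q\le |E(H)|$, an $(H,q)$-coloring of $G$ is an edge-coloring of $G$ in which every subgraph of $G$ isomorphic to $H$ receives at least $q$ distinct colors; $r(G,H,q)$ is the minimum number of colors needed for $G$ to have an $(H,q)$-coloring. $K_{a,b}$ denotes the complete bipartite graph with parts of sizes $a$ and $b$. Asymptotic notation refers to $n\to\infty$ with $t$ fixed. *)

theory Defs
  imports Complex_Main "HOL-Library.Landau_Symbols" "HOL-Library.FuncSet"
begin

record 'a ugraph =
  verts :: "'a set"
  edges :: "'a set set"

definition simple_graph :: "'a ugraph \<Rightarrow> bool" where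
  "simple_graph G \<longleftrightarrow> (\<forall>e\<in>edges G. e \<subseteq> verts G \<and> card e = 2)"

definition subgraph_of :: "'a ugraph \<Rightarrow> 'a ugraph \<Rightarrow> bool" where
  "subgraph_of S G \<longleftrightarrow> simple_graph S \<and> verts S \<subseteq> verts G \<and> edges S \<subseteq> edges G"

definition graph_iso :: "'a ugraph \<Rightarrow> 'b ugraph \<Rightarrow> bool" where
  "graph_iso S H \<longleftrightarrow>
     (\<exists>f. bij_betw f (verts S) (verts H) \<and>
          (\<forall>u\<in>verts S. \<forall>v\<in>verts S. {u, v} \<in> edges S \<longleftrightarrow> {f u, f v} \<in> edges H))"

definition complete_bipartite :: "nat \<Rightarrow> nat \<Rightarrow> (nat + nat) ugraph" where
  "complete_bipartite a b =
     \<lparr>verts = {..<a} <+> {..<b},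
      edges = {{Inl i, Inr j} | i j. i < a \<and> j < b}\<rparr>"

text \<open>Subgraphs need not be induced. Colours are natural numbers; only the values
  of the colouring on the edges of \<open>G\<close> matter.\<close>

definition Hq_coloring ::
  "'a ugraph \<Rightarrow> 'b ugraph \<Rightarrow> nat \<Rightarrow> ('a set \<Rightarrow> nat) \<Rightarrow> bool" where
  "Hq_coloring G H q c \<longleftrightarrow>
     (\<forall>S. subgraph_of S G \<and> graph_iso S H \<longrightarrow> q \<le> card (c ` edges S))"

text \<open>The least number is attained whenever \<open>G\<close> is finite and \<open>q \<le> card (edges H)\<close>, see
  \<open>ramsey_num_attained\<close> below.\<close>

definition ramsey_num :: "'a ugraph \<Rightarrow> 'b ugraph \<Rightarrow> nat \<Rightarrow> nat" where
  "ramsey_num G H q =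
     (LEAST k. \<exists>c. c \<in> edges G \<rightarrow> {..<k} \<and> Hq_coloring G H q c)"

lemma simple_graph_complete_bipartite: "simple_graph (complete_bipartite a b)"
  by (auto simp: simple_graph_def complete_bipartite_def)

lemma card_edges_complete_bipartite: "card (edges (complete_bipartite a b)) = a * b"
proof -
  have "edges (complete_bipartite a b)
      = (\<lambda>(i, j). {Inl i, Inr j}) ` ({..<a} \<times> {..<b})"
    by (auto simp: complete_bipartite_def)
  moreover have "inj_on (\<lambda>(i::nat, j::nat). {Inl i, Inr j :: nat + nat}) ({..<a} \<times> {..<b})"
    by (auto simp: inj_on_def doubleton_eq_iff)
  ultimately show ?thesis
    by (simp add: card_image)
qed

lemma card_edges_graph_iso:
  assumes "simple_graph S" "simple_graph H" "graph_iso S H"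
  shows "card (edges S) = card (edges H)"
proof -
  obtain f where f: "bij_betw f (verts S) (verts H)"
    and e: "\<And>u v. u \<in> verts S \<Longrightarrow> v \<in> verts S \<Longrightarrow> {u, v} \<in> edges S \<longleftrightarrow> {f u, f v} \<in> edges H"
    using assms(3) unfolding graph_iso_def by blast
  have inj: "inj_on (\<lambda>x. f ` x) (edges S)"
    using f assms(1) unfolding bij_betw_def simple_graph_def
    by (meson inj_onI inj_on_image_eq_iff)
  have "(\<lambda>x. f ` x) ` edges S = edges H"
  proof (intro equalityI subsetI)
    fix y assume "y \<in> (\<lambda>x. f ` x) ` edges S"
    then obtain x where x: "x \<in> edges S" "y = f ` x" by blast
    with assms(1) obtain u v where "x = {u, v}" "u \<in> verts S" "v \<in> verts S"
      unfolding simple_graph_def card_2_iff by fastforce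
    with x e show "y \<in> edges H" by auto
  next
    fix y assume y: "y \<in> edges H"
    with assms(2) obtain p q where pq: "y = {p, q}" "p \<in> verts H" "q \<in> verts H"
      unfolding simple_graph_def card_2_iff by fastforce
    then obtain u v where "p = f u" "q = f v" "u \<in> verts S" "v \<in> verts S"
      using f unfolding bij_betw_def by blast
    with pq y e have "{u, v} \<in> edges S" "y = f ` {u, v}" by auto
    then show "y \<in> (\<lambda>x. f ` x) ` edges S" by blast
  qed
  with inj show ?thesis using card_image by fastforce
qed

lemma ramsey_num_attained:
  assumes "finite (edges G)" "simple_graph H" "q \<le> card (edges H)"
  shows "\<exists>c. c \<in> edges G \<rightarrow> {..<ramsey_num G H q} \<and> Hq_coloring G H q c"
proof -
  obtain c where c: "bij_betw c (edges G) {..<card (edges G)}"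
    using ex_bij_betw_finite_nat[OF assms(1)] by (auto simp: atLeast0LessThan)
  have "q \<le> card (c ` edges S)" if "subgraph_of S G" "graph_iso S H" for S
  proof -
    have "inj_on c (edges S)"
      using c that(1) unfolding bij_betw_def subgraph_of_def by (meson inj_on_subset)
    then have "card (c ` edges S) = card (edges H)"
      using card_edges_graph_iso[of S H] that assms(2)
      by (simp add: card_image subgraph_of_def)
    with assms(3) show ?thesis by simp
  qed
  moreover have "c \<in> edges G \<rightarrow> {..<card (edges G)}"
    using c by (auto simp: bij_betw_def)
  ultimately have "\<exists>k c. c \<in> edges G \<rightarrow> {..<k} \<and> Hq_coloring G H q c"
    unfolding Hq_coloring_def by blast
  then show ?thesis
    unfolding ramsey_num_def by (rule LeastI_ex)
qed

end

theory Submission imports Defs begin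

text \<open>
  If few colours occur, many pairs of edges \<open>x1 y1\<close>, \<open>x2 y2\<close> share a colour. These pairs are the edges of
  the bipartite energy graph, which joins \<open>(x1, x2)\<close> to \<open>(y1, y2)\<close>. A copy of the 1-subdivision of
  \<open>K\<^sub>t\<close> in the energy graph, with branch vertices on the left and all \<open>t + (t choose 2)\<close> vertices
  pairwise disjoint as pairs, spans \<open>K\<^bsub>2t,t(t-1)\<^esub>\<close> with one colour repetition for each of its
  \<open>t(t - 1)\<close> edges, which the colouring forbids. By Janzer's argument such a subdivision exists once a
  balanced bipartite graph with parts of size \<open>N\<close> has at least \<open>C N\<^bsup>1 + (t-2)/(2t-3)\<^esup>\<close> edges; here \<open>N = n\<^sup>2\<close>.

  Two branch vertices are heavy if they have at least \<open>t\<^sup>2\<close> common neighbours and light if they have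
  fewer, but at least one. \<open>t\<close> pairwise heavy vertices give a subdivision greedily, so every
  neighbourhood contains many light pairs, and one can repeatedly pass to the light neighbourhood of a
  vertex \<open>t - 1\<close> times, discarding the few vertices through which two subdivision vertices could collide.
\<close>

section \<open>Independent choices\<close>

text \<open>With \<open>k\<close> colours, convexity over the colour classes gives the energy graph
  about \<open>n^4 / k\<close> edges on parts of size \<open>n^2\<close>; comparing this with the
  density threshold gives the exponent \<open>1 + 1/(2t-3)\<close>. The threshold itself balances
  the shrinking: with degrees about \<open>\<delta>\<close> and parts of size about
  \<open>m\<close>, a light neighbourhood keeps a fraction of order \<open>\<delta>^2 / m\<close>,
  and both the last shrinking step and the choice of the last vertex require
  \<open>\<delta>^(2t-3)\<close> to exceed a constant times \<open>m^(t-2)\<close>. The obstacle is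
  disjointness of the pairs. The colouring itself limits large monochromatic stars, so after
  deleting at most half of the edges every colour degree is bounded by a constant. The
  neighbourhoods in the energy graph can then be thinned, at constant cost, to pairwise disjoint
  pairs. From then on a pair conflicts with at most two members of any one neighbourhood, which is
  all that the abstract conflict relation records. Conflicts across different neighbourhoods remain;
  the \<open>bad\<close> sets remove them during the shrinking.\<close>

lemma independent_subset:
  assumes "finite S" and sym: "\<And>x y. conf x y \<Longrightarrow> conf y x"
    and refl: "\<And>x. conf x x"
    and "\<And>x. x \<in> S \<Longrightarrow> card {y \<in> S. conf x y} \<le> D"
  shows "\<exists>I\<subseteq>S. pairwise (\<lambda>x y. \<not> conf x y) I \<and> card S \<le> D * card I"
  using assms(1,4)
proof (induction S rule: finite_psubset_induct)
  case (psubset S)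
  show ?case
  proof (cases "S = {}")
    case True
    then show ?thesis by (intro exI[of _ "{}"]) auto
  next
    case False
    then obtain x where x: "x \<in> S" by blast
    \<comment> \<open>Keeping \<open>x\<close> costs at most \<open>D\<close> elements,
      \<open>x\<close> among them because \<open>conf\<close> is reflexive, and adds one to the
      independent set.\<close>
    define S' where "S' = {y \<in> S. \<not> conf x y}"
    have "card {y \<in> S'. conf z y} \<le> D" if "z \<in> S'" for z
    proof -
      have "card {y \<in> S'. conf z y} \<le> card {y \<in> S. conf z y}"
        using psubset.hyps by (intro card_mono) (auto simp: S'_def)
      then show ?thesis using psubset.prems[of z] that by (auto simp: S'_def)
    qed
    moreover have "S' \<subset> S" using x refl by (auto simp: S'_def)
    ultimately obtain I where I: "I \<subseteq> S'" "pairwise (\<lambda>x y. \<not> conf x y) I" "card S' \<le> D * card I"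
      using psubset.IH[of S'] by blast
    have "finite I" using I(1) psubset.hyps by (auto simp: S'_def intro: finite_subset)
    moreover have "x \<notin> I" using I(1) refl by (auto simp: S'_def)
    ultimately have c: "card (insert x I) = Suc (card I)" by simp
    have "card S = card (S' \<union> {y \<in> S. conf x y})"
      by (rule arg_cong[where f=card]) (auto simp: S'_def)
    also have "\<dots> \<le> card S' + card {y \<in> S. conf x y}" by (rule card_Un_le)
    also have "\<dots> \<le> D * card (insert x I)" using I(3) psubset.prems[OF x] c by simp
    finally have "card S \<le> D * card (insert x I)" .
    moreover have "pairwise (\<lambda>x y. \<not> conf x y) (insert x I)"
      using I sym unfolding pairwise_insert S'_def by blast
    ultimately show ?thesis using I(1) x unfolding S'_def by (intro exI[of _ "insert x I"]) auto
  qed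
qed

text \<open>Greedy choice: every earlier choice rules out at most \<open>D\<close> candidates, so a
  candidate set with more than \<open>D * card P\<close> elements is never exhausted.\<close>

lemma independent_choice:
  assumes "finite P" and sym: "\<And>x y. conf x y \<Longrightarrow> conf y x"
    and "\<And>p. p \<in> P \<Longrightarrow> finite (C p)"
    and "\<And>p w. p \<in> P \<Longrightarrow> card {w' \<in> C p. conf w w'} \<le> D"
    and "\<And>p. p \<in> P \<Longrightarrow> D * card P < card (C p)"
  shows "\<exists>w. (\<forall>p\<in>P. w p \<in> C p) \<and> (\<forall>p\<in>P. \<forall>q\<in>P. p \<noteq> q \<longrightarrow> \<not> conf (w p) (w q))"
  using assms(1,3-)
proof (induction P rule: finite_induct)
  case empty
  then show ?case by simp
next
  case (insert p P)
  have "D * card P < card (C q)" if "q \<in> P" for q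
    using insert.prems(3)[of q] insert.hyps that by simp
  then have "\<exists>w. (\<forall>p\<in>P. w p \<in> C p) \<and> (\<forall>p\<in>P. \<forall>q\<in>P. p \<noteq> q \<longrightarrow> \<not> conf (w p) (w q))"
    using insert.prems(1,2) by (intro insert.IH) auto
  then obtain w where w: "\<forall>p\<in>P. w p \<in> C p"
      "\<forall>p\<in>P. \<forall>q\<in>P. p \<noteq> q \<longrightarrow> \<not> conf (w p) (w q)"
    by blast
  define bad where "bad = (\<Union>q\<in>P. {w' \<in> C p. conf (w q) w'})"
  have "card bad \<le> (\<Sum>q\<in>P. card {w' \<in> C p. conf (w q) w'})"
    unfolding bad_def by (rule card_UN_le[OF insert.hyps(1)])
  also have "\<dots> \<le> D * card P"
    using sum_bounded_above[of P "\<lambda>q. card {w' \<in> C p. conf (w q) w'}" D] insert.prems(2)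
    by (simp add: mult.commute)
  also have "\<dots> < card (C p)"
    using insert.prems(3)[of p] insert.hyps by simp
  finally have "\<not> C p \<subseteq> bad"
    using card_mono[of bad "C p"] insert.prems(1) insert.hyps by (auto simp: bad_def)
  then obtain v where v: "v \<in> C p" "v \<notin> bad" by blast
  have "\<not> conf (w q) v" if "q \<in> P" for q using v that by (auto simp: bad_def)
  then have "\<not> conf (w q) v \<and> \<not> conf v (w q)" if "q \<in> P" for q using that sym by blast
  with w v insert.hyps show ?case by (intro exI[of _ "w(p := v)"]) auto
qed

section \<open>Averaging inequalities\<close>

text \<open>The \<open>s\<close> largest values average at least as much as all of them, written
  without division. The induction runs downwards from \<open>card A\<close> and drops a minimal
  element each time.\<close>

lemma heavy_subset:
  fixes f :: "'a \<Rightarrow> real"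
  assumes "finite A" "s \<le> card A"
  shows "\<exists>A'\<subseteq>A. card A' = s \<and> real s * sum f A \<le> real (card A) * sum f A'"
  using assms(2)
proof (induction s rule: inc_induct)
  case base
  then show ?case by (intro exI[of _ A]) auto
next
  case (step s)
  then obtain A' where A': "A' \<subseteq> A" "card A' = Suc s"
    "real (Suc s) * sum f A \<le> real (card A) * sum f A'" by blast
  have fin: "finite A'" "A' \<noteq> {}" using A' assms(1) finite_subset by auto
  define x where "x = arg_min_on f A'"
  have x: "x \<in> A'" "\<And>y. y \<in> A' \<Longrightarrow> f x \<le> f y"
    using arg_min_if_finite[OF fin, of f] unfolding x_def by (auto simp: not_less)
  have "real (Suc s) * f x \<le> sum f A'"
    using sum_bounded_below[of A' "f x" f] x A'(2) by simp
  then have "real s * sum f A' \<le> real (Suc s) * (sum f A' - f x)" by (simp add: algebra_simps)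
  then have "real (card A) * (real s * sum f A') \<le> real (card A) * (real (Suc s) * (sum f A' - f x))"
    by (rule mult_left_mono) simp
  moreover have "real s * (real (Suc s) * sum f A) \<le> real s * (real (card A) * sum f A')"
    using A'(3) by (rule mult_left_mono) simp
  ultimately have "real (Suc s) * (real s * sum f A) \<le> real (Suc s) * (real (card A) * (sum f A' - f x))"
    by (simp add: algebra_simps)
  then have "real s * sum f A \<le> real (card A) * (sum f A' - f x)"
    by (rule mult_left_le_imp_le) simp
  then show ?case using x A' fin by (intro exI[of _ "A' - {x}"]) (auto simp: sum_diff1)
qed

lemma sum_squared_div_le:
  fixes f :: "'a \<Rightarrow> real" and m :: real
  assumes "card I \<le> m" "m > 0"
  shows "(sum f I)\<^sup>2 / m \<le> (\<Sum>i\<in>I. (f i)\<^sup>2)"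
proof -
  \<comment> \<open>Cauchy-Schwarz by tangents: each square is at least
    \<open>2 * c * f i - c\<^sup>2\<close>. Since \<open>m\<close> only bounds
    \<open>card I\<close>, \<open>c\<close> need not be the mean, but the error has the right
    sign.\<close>
  define c where "c = sum f I / m"
  have "card I * c\<^sup>2 \<le> m * c\<^sup>2" using assms(1) by (intro mult_right_mono) auto
  then have "(sum f I)\<^sup>2 / m \<le> 2 * c * sum f I - card I * c\<^sup>2"
    using assms(2) by (simp add: c_def power2_eq_square)
  also have "\<dots> = (\<Sum>i\<in>I. 2 * c * f i - c\<^sup>2)"
    by (simp add: sum_subtractf sum_distrib_left)
  also have "\<dots> \<le> (\<Sum>i\<in>I. (f i)\<^sup>2)"
  proof (intro sum_mono)
    fix i
    have "0 \<le> (f i - c)\<^sup>2" by simp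
    then show "2 * c * f i - c\<^sup>2 \<le> (f i)\<^sup>2" by (simp add: power2_eq_square algebra_simps)
  qed
  finally show ?thesis .
qed

section \<open>Subdivisions in bipartite graphs with conflicts\<close>

text \<open>
  The relation \<open>conf\<close> only constrains the right-hand vertices: distinct branch vertices of a subdivision
  have a common neighbour, so their disjointness is an assumption on neighbourhoods imposed later.
\<close>

locale conflict_graph =
  fixes F :: "('a \<times> 'b) set" and conf :: "'b \<Rightarrow> 'b \<Rightarrow> bool"
  assumes finite_F: "finite F"
    and conf_refl: "conf w w"
    and conf_sym: "conf w w' \<Longrightarrow> conf w' w"
    and nonconf: "(a, w) \<in> F \<Longrightarrow> (a, w') \<in> F \<Longrightarrow> w \<noteq> w' \<Longrightarrow> \<not> conf w w'"
    and few_conf: "card {w'. (a, w') \<in> F \<and> conf w w'} \<le> 2"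
begin

text \<open>\<open>nb {}\<close> is the whole type, hence the assumptions
  \<open>e \<noteq> {}\<close> in the bounds on \<open>nb e\<close>.\<close>

definition nb :: "'a set \<Rightarrow> 'b set" where
  "nb e = {w. \<forall>p\<in>e. (p, w) \<in> F}"

text \<open>\<open>w\<close> is indexed by unordered pairs, one subdividing vertex per edge of the
  complete graph on \<open>Q\<close>. Since \<open>conf\<close> is reflexive, the last clause also
  makes these vertices distinct.\<close>

definition subdivision :: "nat \<Rightarrow> 'a set \<Rightarrow> ('a set \<Rightarrow> 'b) \<Rightarrow> bool" where
  "subdivision t Q w \<longleftrightarrow> card Q = t \<and>
     (\<forall>e. e \<subseteq> Q \<longrightarrow> card e = 2 \<longrightarrow> w e \<in> nb e) \<and>
     (\<forall>e e'. e \<subseteq> Q \<longrightarrow> card e = 2 \<longrightarrow> e' \<subseteq> Q \<longrightarrow> card e' = 2 \<longrightarrow> e \<noteq> e' \<longrightarrow> \<not> conf (w e) (w e'))"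

definition light :: "nat \<Rightarrow> 'a \<Rightarrow> 'a \<Rightarrow> bool" where
  "light t p q \<longleftrightarrow> p \<noteq> q \<and> nb {p, q} \<noteq> {} \<and> card (nb {p, q}) < t\<^sup>2"

lemma finite_nb: "e \<noteq> {} \<Longrightarrow> finite (nb e)"
proof -
  assume "e \<noteq> {}"
  then obtain p where "p \<in> e" by blast
  then have "nb e \<subseteq> snd ` F" by (force simp: nb_def)
  then show ?thesis using finite_F finite_subset by blast
qed

lemma light_sym: "light t p q \<Longrightarrow> light t q p"
  by (auto simp: light_def insert_commute)

lemma few_conf_nb:
  assumes "e \<noteq> {}"
  shows "card {w' \<in> nb e. conf w w'} \<le> 2"
proof -
  obtain p where "p \<in> e" using assms by blast
  then have "card {w' \<in> nb e. conf w w'} \<le> card {w'. (p, w') \<in> F \<and> conf w w'}"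
    using finite_nb[of "{p}"] by (intro card_mono) (auto simp: nb_def)
  then show ?thesis using few_conf[of p w] by linarith
qed

section \<open>Heavy and light pairs\<close>

text \<open>This explains the heaviness threshold: each chosen subdividing vertex blocks at most two
  candidates for another pair, and twice the number of pairs is
  \<open>t * (t - 1) < t\<^sup>2\<close>.\<close>

lemma heavy_clique_subdivision:
  assumes "card Q = t" "t \<ge> 1"
    and "\<And>p q. p \<in> Q \<Longrightarrow> q \<in> Q \<Longrightarrow> p \<noteq> q \<Longrightarrow> t\<^sup>2 \<le> card (nb {p, q})"
  shows "\<exists>w. subdivision t Q w"
proof -
  define P where "P = {e. e \<subseteq> Q \<and> card e = 2}"
  have "finite Q" using assms card.infinite by fastforce
  then have P: "finite P" "card P = t choose 2"
    using n_subsets[of Q 2] assms(1) by (auto simp: P_def)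
  have "2 * card P = t * (t - 1)"
    using P by (cases t) (simp_all add: choose_two)
  then have "2 * card P < t\<^sup>2"
    using assms(2) by (cases t) (auto simp: power2_eq_square)
  moreover have "t\<^sup>2 \<le> card (nb e)" if "e \<in> P" for e
    using that assms(3) by (auto simp: P_def card_2_iff)
  ultimately have "\<And>e. e \<in> P \<Longrightarrow> 2 * card P < card (nb e)" by fastforce
  moreover have "\<And>e. e \<in> P \<Longrightarrow> e \<noteq> {}" by (auto simp: P_def)
  ultimately have "\<exists>w. (\<forall>e\<in>P. w e \<in> nb e) \<and> (\<forall>e\<in>P. \<forall>e'\<in>P. e \<noteq> e' \<longrightarrow> \<not> conf (w e) (w e'))"
    using P(1) conf_sym finite_nb few_conf_nb
    by (intro independent_choice[where D=2]) blast+
  then show ?thesis using assms(1) unfolding subdivision_def P_def by blast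
qed

text \<open>A Turan-type bound: \<open>t\<close> pairwise heavy vertices would give a subdivision,
  so the graph of non-heavy pairs has no independent set of size \<open>t\<close> and must be dense.
  The subtracted \<open>card M\<close> is the diagonal, which \<open>cf\<close> contains.\<close>

lemma many_non_heavy_pairs:
  assumes "\<And>Q w. \<not> subdivision t Q w" "t \<ge> 1" "finite M"
  shows "real (card M) ^ 2 / (4 * t) - card M
    \<le> card {(p, q). p \<in> M \<and> q \<in> M \<and> p \<noteq> q \<and> card (nb {p, q}) < t\<^sup>2}"
proof -
  define cf where "cf p q \<longleftrightarrow> p = q \<or> card (nb {p, q}) < t\<^sup>2" for p q
  have cf: "cf p p" "cf p q \<Longrightarrow> cf q p" for p q by (auto simp: cf_def insert_commute)
  \<comment> \<open>An independent set has fewer than \<open>t\<close> elements, so the part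
    \<open>M'\<close> of low degree has at most \<open>D * t\<close> elements, at most half of
    \<open>M\<close>. Every other vertex is in conflict with more than \<open>D\<close>
    vertices.\<close>
  define D where "D = card M div (2 * t)"
  define M' where "M' = {p \<in> M. card {q \<in> M. cf p q} \<le> D}"
  have "card {q \<in> M'. cf p q} \<le> D" if "p \<in> M'" for p
  proof -
    have "card {q \<in> M'. cf p q} \<le> card {q \<in> M. cf p q}"
      using assms(3) by (intro card_mono) (auto simp: M'_def)
    then show ?thesis using that by (auto simp: M'_def)
  qed
  moreover have "finite M'" using assms(3) by (simp add: M'_def)
  ultimately obtain I where I: "I \<subseteq> M'" "pairwise (\<lambda>p q. \<not> cf p q) I" "card M' \<le> D * card I"
    using independent_subset[of M' cf D] cf by blast
  have "card I < t"
  proof (rule ccontr)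
    assume "\<not> card I < t"
    then obtain Q where Q: "Q \<subseteq> I" "card Q = t" by (meson not_less obtain_subset_with_card_n)
    have "t\<^sup>2 \<le> card (nb {p, q})" if "p \<in> Q" "q \<in> Q" "p \<noteq> q" for p q
      using I(2) Q(1) that unfolding pairwise_def cf_def by (meson not_less subsetD)
    then have "\<exists>w. subdivision t Q w"
      by (intro heavy_clique_subdivision assms(2) Q(2))
    then show False using assms(1) by blast
  qed
  then have "card M' \<le> D * t" using I(3) by (meson le_trans less_imp_le mult_le_mono2)
  moreover have "D * (2 * t) \<le> card M"
    unfolding D_def by (rule div_times_less_eq_dividend)
  ultimately have "2 * card M' \<le> card M" by linarith
  then have half: "2 * real (card M') \<le> card M" by linarith
  have diff: "real (card (M - M')) = real (card M) - card M'"
    using assms(3) by (subst card_Diff_subset) (auto simp: M'_def intro!: of_nat_diff card_mono)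
  have "card M < (D + 1) * (2 * t)"
    unfolding D_def using assms(2) dividend_less_div_times[of "2*t" "card M"] by (simp add: algebra_simps)
  then have Dl: "real (card M) / (2 * t) \<le> D + 1"
    using assms(2) by (simp add: field_simps flip: of_nat_mult of_nat_add of_nat_Suc)
  have "real (card M) ^ 2 / (4 * t) = (real (card M) / 2) * (real (card M) / (2 * t))"
    by (simp add: power2_eq_square)
  also have "\<dots> \<le> real (card (M - M')) * (D + 1)"
    using half diff Dl by (intro mult_mono) auto
  also have "\<dots> = (\<Sum>p\<in>M - M'. real (D + 1))" by simp
  also have "\<dots> \<le> (\<Sum>p\<in>M - M'. real (card {q \<in> M. cf p q}))"
    by (intro sum_mono) (auto simp: M'_def)
  also have "\<dots> \<le> (\<Sum>p\<in>M. real (card {q \<in> M. cf p q}))"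
    using assms(3) by (intro sum_mono2) auto
  also have "\<dots> \<le> (\<Sum>p\<in>M. 1 + real (card {q \<in> M. p \<noteq> q \<and> card (nb {p, q}) < t\<^sup>2}))"
  proof (intro sum_mono)
    fix p
    have "{q \<in> M. cf p q} \<subseteq> insert p {q \<in> M. p \<noteq> q \<and> card (nb {p, q}) < t\<^sup>2}"
      by (auto simp: cf_def)
    then have "card {q \<in> M. cf p q} \<le> Suc (card {q \<in> M. p \<noteq> q \<and> card (nb {p, q}) < t\<^sup>2})"
      using assms(3) card_mono[of "insert p {q \<in> M. p \<noteq> q \<and> card (nb {p, q}) < t\<^sup>2}" "{q \<in> M. cf p q}"]
      by simp
    then show "real (card {q \<in> M. cf p q}) \<le> 1 + real (card {q \<in> M. p \<noteq> q \<and> card (nb {p, q}) < t\<^sup>2})"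
      by linarith
  qed
  also have "\<dots> = card M + card (SIGMA p:M. {q \<in> M. p \<noteq> q \<and> card (nb {p, q}) < t\<^sup>2})"
    using assms(3) by (simp add: sum.distrib)
  also have "(SIGMA p:M. {q \<in> M. p \<noteq> q \<and> card (nb {p, q}) < t\<^sup>2})
      = {(p, q). p \<in> M \<and> q \<in> M \<and> p \<noteq> q \<and> card (nb {p, q}) < t\<^sup>2}" by auto
  finally show ?thesis by simp
qed


text \<open>Double counting of non-heavy pairs through their common neighbours. On average over
  \<open>b\<close>, the neighbourhood of \<open>b\<close> holds quadratically many, and each pair
  arises from fewer than \<open>t\<^sup>2\<close> vertices \<open>b\<close>; averaging over
  \<open>U\<close> then gives a vertex of large light degree.\<close>

lemma light_degree_step:
  fixes \<delta> m :: real
  assumes nosub: "\<And>Q w. \<not> subdivision t Q w" and "t \<ge> 1"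
    and U: "finite U" "U \<noteq> {}" and B: "finite B" "F \<subseteq> UNIV \<times> B" "card B \<le> m" "m > 0"
    and deg: "\<And>u. u \<in> U \<Longrightarrow> \<delta> \<le> card (nb {u})" "\<delta> > 0"
    and large: "8 * t * m \<le> \<delta> * card U"
  shows "\<exists>u\<in>U. \<delta>\<^sup>2 * card U / (8 * t ^ 3 * m) \<le> card {v \<in> U. light t u v}"
proof (rule ccontr)
  assume contra: "\<not> ?thesis"
  define N where "N b = {u \<in> U. (u, b) \<in> F}" for b
  define L where "L b = {(p, q). p \<in> N b \<and> q \<in> N b \<and> p \<noteq> q \<and> card (nb {p, q}) < t\<^sup>2}" for b
  define P where "P = {(p, q). p \<in> U \<and> q \<in> U \<and> light t p q}"
  define s where "s = (\<Sum>b\<in>B. real (card (N b)))"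
  have fN: "finite (N b)" for b using U by (simp add: N_def)
  have tpos: "real t > 0" using assms(2) by simp
  have nbB: "nb {u} = {b \<in> B. (u, b) \<in> F}" for u using B(2) by (auto simp: nb_def)
  have "s = (\<Sum>b\<in>B. \<Sum>u\<in>U. of_bool ((u, b) \<in> F))"
    unfolding s_def N_def using U(1) by (simp add: Int_def conj_commute)
  also have "\<dots> = (\<Sum>u\<in>U. \<Sum>b\<in>B. of_bool ((u, b) \<in> F))" by (rule sum.swap)
  also have "\<dots> = (\<Sum>u\<in>U. real (card (nb {u})))"
    unfolding nbB using B(1) by (simp add: Int_def conj_commute)
  also have "\<dots> \<ge> card U * \<delta>" using deg(1) by (intro sum_bounded_below) auto
  finally have s: "\<delta> * card U \<le> s" by (simp add: mult.commute)
  have "0 < \<delta> * card U" using U deg(2) by (simp add: card_gt_0_iff)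
  then have spos: "0 < s" using s by linarith
  have cs: "s\<^sup>2 / m \<le> (\<Sum>b\<in>B. (real (card (N b)))\<^sup>2)"
    unfolding s_def using B(3,4) by (rule sum_squared_div_le)
  \<comment> \<open>\<open>large\<close> bounds the diagonal loss \<open>s\<close> by half of the
    main term.\<close>
  have "8 * t * m * s \<le> s * s" using large s spos by (intro mult_right_mono) auto
  then have "s \<le> s\<^sup>2 / (8 * t * m)" using tpos B(4) by (simp add: field_simps power2_eq_square)
  moreover have "s\<^sup>2 / (8 * t * m) + s\<^sup>2 / (8 * t * m) = s\<^sup>2 / m / (4 * t)" by simp
  ultimately have "s\<^sup>2 / (8 * t * m) \<le> s\<^sup>2 / m / (4 * t) - s" by linarith
  also have "\<dots> \<le> (\<Sum>b\<in>B. (real (card (N b)))\<^sup>2) / (4 * t) - s"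
    using cs tpos by (intro diff_right_mono divide_right_mono) auto
  also have "\<dots> = (\<Sum>b\<in>B. (real (card (N b)))\<^sup>2 / (4 * t) - card (N b))"
    by (simp add: s_def sum_subtractf sum_divide_distrib)
  also have "\<dots> \<le> (\<Sum>b\<in>B. real (card (L b)))"
    unfolding L_def by (intro sum_mono many_non_heavy_pairs nosub assms(2) fN)
  \<comment> \<open>Inside \<open>N b\<close> a non-heavy pair is automatically light:
    \<open>b\<close> witnesses that its common neighbourhood is nonempty.\<close>
  also have "\<dots> \<le> (\<Sum>b\<in>B. \<Sum>(p, q)\<in>P. of_bool (b \<in> nb {p, q}))"
  proof (intro sum_mono)
    fix b
    have fP: "finite P" by (rule finite_subset[of _ "U \<times> U"]) (use U in \<open>auto simp: P_def\<close>)
    have "L b \<subseteq> {x \<in> P. case x of (p, q) \<Rightarrow> b \<in> nb {p, q}}"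
      by (auto simp: L_def P_def N_def light_def nb_def)
    then have "card (L b) \<le> card {x \<in> P. case x of (p, q) \<Rightarrow> b \<in> nb {p, q}}"
      using fP by (intro card_mono) auto
    also have "real (card {x \<in> P. case x of (p, q) \<Rightarrow> b \<in> nb {p, q}})
        = (\<Sum>(p, q)\<in>P. of_bool (b \<in> nb {p, q}))"
      using fP by (simp add: case_prod_beta Int_def conj_commute)
    finally show "real (card (L b)) \<le> (\<Sum>(p, q)\<in>P. of_bool (b \<in> nb {p, q}))" by simp
  qed
  also have "\<dots> = (\<Sum>(p, q)\<in>P. \<Sum>b\<in>B. of_bool (b \<in> nb {p, q}))"
    by (subst sum.swap) (simp add: case_prod_beta)
  also have "\<dots> \<le> (\<Sum>x\<in>P. (real t)\<^sup>2)"
  proof (intro sum_mono)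
    fix x assume "x \<in> P"
    obtain p q where x: "x = (p, q)" by fastforce
    with \<open>x \<in> P\<close> have "card (nb {p, q}) < t\<^sup>2" by (auto simp: P_def light_def)
    moreover have "card (B \<inter> {b. b \<in> nb {p, q}}) \<le> card (nb {p, q})"
      by (intro card_mono finite_nb) auto
    ultimately have "card (B \<inter> {b. b \<in> nb {p, q}}) \<le> t\<^sup>2" by linarith
    moreover have "(case x of (p, q) \<Rightarrow> \<Sum>b\<in>B. of_bool (b \<in> nb {p, q})) = real (card (B \<inter> {b. b \<in> nb {p, q}}))"
      using B(1) x by simp
    ultimately show "(case x of (p, q) \<Rightarrow> \<Sum>b\<in>B. of_bool (b \<in> nb {p, q})) \<le> (real t)\<^sup>2"
      by (metis of_nat_le_iff of_nat_power)
  qed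
  also have "\<dots> = (real t)\<^sup>2 * card P" by simp
  finally have lower: "s\<^sup>2 / (8 * t * m) \<le> (real t)\<^sup>2 * card P" .
  have "P = (SIGMA u:U. {v \<in> U. light t u v})" by (auto simp: P_def)
  then have "real (card P) = (\<Sum>u\<in>U. real (card {v \<in> U. light t u v}))"
    using U(1) by simp
  also have "\<dots> < (\<Sum>u\<in>U. \<delta>\<^sup>2 * card U / (8 * t ^ 3 * m))"
    using contra U by (intro sum_strict_mono) auto
  also have "\<dots> = (\<delta> * card U)\<^sup>2 / (8 * t ^ 3 * m)" by (simp add: power2_eq_square)
  also have "\<dots> \<le> s\<^sup>2 / (8 * t ^ 3 * m)"
    using s \<open>0 < \<delta> * card U\<close> B(4) by (intro divide_right_mono power_mono) auto
  finally have "(real t)\<^sup>2 * card P < (real t)\<^sup>2 * (s\<^sup>2 / (8 * t ^ 3 * m))"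
    using tpos by (intro mult_strict_left_mono) auto
  also have "\<dots> = s\<^sup>2 / (8 * t * m)"
    using tpos by (simp add: power2_eq_square power3_eq_cube)
  finally show False using lower by linarith
qed

text \<open>
  \<open>bad Q\<close> collects the vertices whose addition to \<open>Q\<close> would create a conflict between possible
  subdivision vertices of two different pairs.
\<close>

definition bad :: "'a set \<Rightarrow> 'a set" where
  "bad Q = (\<Union>e\<in>{e. e \<subseteq> Q \<and> card e = 2}. \<Union>w\<in>nb e. \<Union>r\<in>Q.
     \<Union>w'\<in>{w' \<in> nb {r}. conf w w'}. {a. (a, w') \<in> F})"

text \<open>All common neighbours are compared, not one chosen per pair, so that the subdividing
  vertices can be picked arbitrarily at the end.\<close>

definition separated :: "'a set \<Rightarrow> bool" where
  "separated Q \<longleftrightarrow> (\<forall>e e'. e \<subseteq> Q \<longrightarrow> card e = 2 \<longrightarrow> e' \<subseteq> Q \<longrightarrow> card e' = 2 \<longrightarrow> e \<noteq> e' \<longrightarrow>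
     (\<forall>w\<in>nb e. \<forall>w'\<in>nb e'. \<not> conf w w'))"

text \<open>One factor per union in \<open>bad\<close>: at most \<open>t\<^sup>2\<close> pairs,
  fewer than \<open>t\<^sup>2\<close> common neighbours of each because the pair is light, at most
  \<open>t\<close> choices of \<open>r\<close>, at most 2 conflicting neighbours of
  \<open>r\<close>, and at most \<open>\<Delta>\<close> vertices adjacent to each of these.\<close>

lemma card_bad_le:
  assumes "finite Q" "card Q \<le> t"
    and lgt: "\<And>p q. p \<in> Q \<Longrightarrow> q \<in> Q \<Longrightarrow> p \<noteq> q \<Longrightarrow> light t p q"
    and \<Delta>: "\<And>b. card {a. (a, b) \<in> F} \<le> \<Delta>"
  shows "card (bad Q) \<le> 2 * t ^ 5 * \<Delta>"
proof -
  define P where "P = {e. e \<subseteq> Q \<and> card e = 2}"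
  define f where "f w r = (\<Union>w'\<in>{w' \<in> nb {r}. conf w w'}. {a. (a, w') \<in> F})" for w r
  have P: "finite P" "card P \<le> t\<^sup>2"
  proof -
    show "finite P" using assms(1) by (simp add: P_def)
    have "card P = card Q choose 2" using n_subsets[OF assms(1)] by (simp add: P_def)
    also have "\<dots> \<le> card Q * (card Q - 1)" by (simp add: choose_two)
    also have "\<dots> \<le> card Q ^ 2" by (simp add: power2_eq_square)
    also have "\<dots> \<le> t\<^sup>2" using assms(2) by (rule power_mono) simp
    finally show "card P \<le> t\<^sup>2" .
  qed
  have bnd: "card (\<Union>x\<in>X. g x) \<le> n * k" if "finite X" "card X \<le> n" "\<And>x. x \<in> X \<Longrightarrow> card (g x) \<le> k"
    for X and g :: "'x \<Rightarrow> 'y set" and n k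
  proof -
    have "card (\<Union>x\<in>X. g x) \<le> (\<Sum>x\<in>X. card (g x))" by (rule card_UN_le[OF that(1)])
    also have "\<dots> \<le> card X * k" using sum_bounded_above[of X "\<lambda>x. card (g x)" k] that(3) by simp
    also have "\<dots> \<le> n * k" using that(2) by simp
    finally show ?thesis .
  qed
  have f: "card (f w r) \<le> 2 * \<Delta>" for w r
    unfolding f_def using few_conf_nb[of "{r}" w] finite_nb[of "{r}"] \<Delta> by (intro bnd) auto
  have c: "finite (nb e) \<and> card (nb e) \<le> t\<^sup>2" if "e \<in> P" for e
  proof -
    from that obtain p q where "e = {p, q}" "p \<in> Q" "q \<in> Q" "p \<noteq> q"
      unfolding P_def card_2_iff by blast
    with lgt[of p q] show ?thesis using finite_nb[of e] by (auto simp: light_def)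
  qed
  have "card (bad Q) \<le> t\<^sup>2 * (t\<^sup>2 * (t * (2 * \<Delta>)))"
    unfolding bad_def P_def[symmetric] f_def[symmetric]
    using P c assms(1,2) f by (intro bnd) auto
  also have "\<dots> = 2 * t ^ 5 * \<Delta>" by (simp add: power2_eq_square eval_nat_numeral algebra_simps)
  finally show ?thesis .
qed

text \<open>Only pairs containing \<open>v\<close> are new. Against an old pair, a conflict would
  put \<open>v\<close> into \<open>bad Q\<close>. For two new pairs both candidates are neighbours
  of \<open>v\<close>, so a conflict makes them equal; the common vertex then also joins the two old
  ends, which leads back to the previous case.\<close>

lemma separated_insert:
  assumes "separated Q" "v \<notin> Q" "v \<notin> bad Q" "finite Q"
  shows "separated (insert v Q)"
proof -
  have new: "\<exists>p\<in>Q. e = {p, v}" if "e \<subseteq> insert v Q" "card e = 2" "\<not> e \<subseteq> Q" for e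
    using that unfolding card_2_iff by blast
  have old_new: "\<not> conf w w'"
    if "e \<subseteq> Q" "card e = 2" "r \<in> Q" "w \<in> nb e" "w' \<in> nb {r, v}" for e r w w'
  proof
    assume "conf w w'"
    with that have "w' \<in> {w' \<in> nb {r}. conf w w'}" "v \<in> {a. (a, w') \<in> F}" by (auto simp: nb_def)
    with that(1-4) have "v \<in> bad Q" unfolding bad_def by blast
    then show False using assms(3) by contradiction
  qed
  have new_new: "\<not> conf w w'"
    if "p \<in> Q" "r \<in> Q" "p \<noteq> r" "w \<in> nb {p, v}" "w' \<in> nb {r, v}" for p r w w'
  proof
    assume c: "conf w w'"
    have "(v, w) \<in> F" "(v, w') \<in> F" using that by (auto simp: nb_def)
    then have "w = w'" using nonconf c by blast
    then have "w \<in> nb {p, r}" using that by (auto simp: nb_def)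
    then show False using old_new[of "{p, r}" r w w'] that c by auto
  qed
  show ?thesis unfolding separated_def
  proof (intro allI impI ballI)
    fix e e' w w'
    assume *: "e \<subseteq> insert v Q" "card e = 2" "e' \<subseteq> insert v Q" "card e' = 2" "e \<noteq> e'"
      "w \<in> nb e" "w' \<in> nb e'"
    show "\<not> conf w w'"
    proof (cases "e \<subseteq> Q"; cases "e' \<subseteq> Q")
      assume "e \<subseteq> Q" "e' \<subseteq> Q"
      then show ?thesis using assms(1) * unfolding separated_def by blast
    next
      assume "e \<subseteq> Q" "\<not> e' \<subseteq> Q"
      then show ?thesis using new[of e'] old_new * by blast
    next
      assume "\<not> e \<subseteq> Q" "e' \<subseteq> Q"
      then show ?thesis using new[of e] old_new[of e' _ w' w] conf_sym[of w w'] * by blast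
    next
      assume "\<not> e \<subseteq> Q" "\<not> e' \<subseteq> Q"
      then show ?thesis using new[of e] new[of e'] new_new * by blast
    qed
  qed
qed

lemma subdivision_of_separated:
  assumes "card Q = t" "separated Q"
    and lgt: "\<And>p q. p \<in> Q \<Longrightarrow> q \<in> Q \<Longrightarrow> p \<noteq> q \<Longrightarrow> light t p q"
  shows "\<exists>w. subdivision t Q w"
proof -
  define w where "w e = (SOME x. x \<in> nb e)" for e
  have "w e \<in> nb e" if "e \<subseteq> Q" "card e = 2" for e
  proof -
    from that obtain p q where "e = {p, q}" "p \<in> Q" "q \<in> Q" "p \<noteq> q"
      unfolding card_2_iff by blast
    with lgt[of p q] have "nb e \<noteq> {}" by (simp add: light_def)
    then show ?thesis unfolding w_def by (simp add: some_in_eq)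
  qed
  with assms(1,2) have "subdivision t Q w" by (simp add: subdivision_def separated_def)
  then show ?thesis by blast
qed


section \<open>Iterated light neighbourhoods\<close>

text \<open>\<open>Q\<close> holds the branch vertices chosen so far and \<open>U\<close> is the
  reservoir for the next ones. \<open>\<mu>\<close> is half the ratio supplied by
  \<open>light_degree_step\<close>: the other half pays for deleting \<open>bad Q\<close>, which
  \<open>few\<close> limits to half of \<open>U\<close>. The doubled constant in \<open>many\<close>
  has the same origin.\<close>

lemma light_nested_neighbourhoods:
  fixes \<delta> m \<mu> :: real
  assumes nosub: "\<And>Q w. \<not> subdivision t Q w" and "t \<ge> 2"
    and A: "finite A" and B: "finite B" "F \<subseteq> UNIV \<times> B" "card B \<le> m" "m > 0"
    and deg: "\<And>u. u \<in> A \<Longrightarrow> \<delta> \<le> card (nb {u})" "\<delta> > 0"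
    and \<Delta>: "\<And>b. card {a. (a, b) \<in> F} \<le> \<Delta>"
    and \<mu>: "\<mu> = \<delta>\<^sup>2 / (16 * real t ^ 3 * m)"
    and many: "\<And>i. i \<le> t - 2 \<Longrightarrow> 16 * real t * m \<le> \<delta> * (\<mu> ^ i * card A)"
    and few: "\<And>i. i \<le> t - 2 \<Longrightarrow> 4 * real t ^ 5 * real \<Delta> \<le> \<mu> ^ i * card A"
    and "i \<le> t - 1"
  shows "\<exists>Q U. finite Q \<and> card Q = i \<and> U \<subseteq> A \<and> \<mu> ^ i * card A \<le> card U \<and> separated Q \<and>
    (\<forall>p\<in>Q. \<forall>q\<in>Q \<union> U. p \<noteq> q \<longrightarrow> light t p q) \<and> Q \<inter> U = {}"
  using \<open>i \<le> t - 1\<close>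
proof (induction i)
  case 0
  have "separated {}" by (auto simp: separated_def)
  then show ?case by (intro exI[of _ "{}"] exI[of _ A]) auto
next
  case (Suc i)
  have i: "i \<le> t - 2" "i \<le> t" using Suc.prems assms(2) by auto
  obtain Q U where Q: "finite Q" "card Q = i" "separated Q" and U: "U \<subseteq> A" "\<mu> ^ i * card A \<le> card U"
    and QU: "\<forall>p\<in>Q. \<forall>q\<in>Q \<union> U. p \<noteq> q \<longrightarrow> light t p q" "Q \<inter> U = {}"
    using Suc by auto
  have tpos: "real t > 0" and t1: "t \<ge> 1" using assms(2) by auto
  have fU: "finite U" using U(1) A finite_subset by blast
  define U' where "U' = U - bad Q"
  have "card (bad Q) \<le> 2 * t ^ 5 * \<Delta>"
    using Q i QU by (intro card_bad_le \<Delta>) auto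
  then have "real (card (bad Q)) \<le> real (2 * t ^ 5 * \<Delta>)" by (rule of_nat_mono)
  then have "2 * real (card (bad Q)) \<le> 4 * real t ^ 5 * real \<Delta>" by (simp add: mult_ac)
  also have "\<dots> \<le> card U" using few[OF i(1)] U(2) by linarith
  finally have b: "2 * real (card (bad Q)) \<le> card U" .
  have "card U \<le> card (U' \<union> bad Q)"
  proof (rule card_mono)
    show "finite (U' \<union> bad Q)"
    proof -
      have "bad Q \<subseteq> fst ` F" by (force simp: bad_def)
      then show ?thesis using fU finite_F finite_subset unfolding U'_def by blast
    qed
  qed (auto simp: U'_def)
  also have "\<dots> \<le> card U' + card (bad Q)" by (rule card_Un_le)
  finally have half: "card U \<le> 2 * real (card U')" using b by linarith
  have "16 * real t * m \<le> \<delta> * card U"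
    using many[OF i(1)] mult_left_mono[OF U(2), of \<delta>] deg(2) by linarith
  also have "\<dots> \<le> \<delta> * (2 * real (card U'))" using half deg(2) by (intro mult_left_mono) auto
  finally have l: "8 * real t * m \<le> \<delta> * card U'" by (simp add: mult_ac)
  moreover have "0 < 8 * real t * m" using tpos B by simp
  ultimately have "U' \<noteq> {}" using deg(2) by auto
  have U': "finite U'" "U' \<subseteq> U" using fU by (auto simp: U'_def)
  obtain u where u: "u \<in> U'" "\<delta>\<^sup>2 * card U' / (8 * real t ^ 3 * m) \<le> card {v \<in> U'. light t u v}"
    using light_degree_step[OF nosub t1 U'(1) \<open>U' \<noteq> {}\<close> B _ deg(2) l] U'(2) U(1) deg(1)
    by blast
  define U'' where "U'' = {v \<in> U'. light t u v}"
  have "\<mu> ^ Suc i * card A = \<mu> * (\<mu> ^ i * card A)" by simp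
  also have "\<dots> \<le> \<mu> * (2 * card U')"
    using U(2) half \<mu> B(4) by (intro mult_left_mono) auto
  also have "\<dots> = \<delta>\<^sup>2 * card U' / (8 * real t ^ 3 * m)" by (simp add: \<mu> mult_ac)
  also have "\<dots> \<le> card U''" using u(2) by (simp add: U''_def)
  finally have "\<mu> ^ Suc i * card A \<le> card U''" .
  moreover have "u \<notin> Q" "u \<in> U" using u(1) QU(2) U'(2) by auto
  moreover have "separated (insert u Q)"
    using Q(3,1) \<open>u \<notin> Q\<close> u(1) by (intro separated_insert) (auto simp: U'_def)
  moreover have "\<forall>p\<in>insert u Q. \<forall>q\<in>insert u Q \<union> U''. p \<noteq> q \<longrightarrow> light t p q"
    using QU \<open>u \<in> U\<close> U'(2) by (auto simp: U''_def intro: light_sym)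
  moreover have "insert u Q \<inter> U'' = {}" using QU(2) U'(2) by (auto simp: U''_def light_def)
  moreover have "U'' \<subseteq> A" using U' U(1) by (auto simp: U''_def)
  ultimately show ?case using Q by (intro exI[of _ "insert u Q"] exI[of _ U'']) simp
qed

text \<open>Bounds for the last stages suffice: the light degree estimate in \<open>A\<close> itself
  yields \<open>2 * \<mu> \<le> 1\<close>, so the powers of \<open>\<mu>\<close> do not increase.
  The last branch vertex is any element of the final reservoir outside \<open>bad Q\<close>, which
  is why \<open>few\<close> is strict and uses the power \<open>t - 1\<close>.\<close>

lemma subdivision_of_regular:
  fixes \<delta> m \<mu> :: real
  assumes "t \<ge> 2"
    and A: "finite A" and B: "finite B" "F \<subseteq> UNIV \<times> B" "card B \<le> m" "m > 0"
    and deg: "\<And>u. u \<in> A \<Longrightarrow> \<delta> \<le> card (nb {u})" "\<delta> > 0"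
    and \<Delta>: "\<And>b. card {a. (a, b) \<in> F} \<le> \<Delta>"
    and \<mu>: "\<mu> = \<delta>\<^sup>2 / (16 * real t ^ 3 * m)"
    and start: "16 * real t * m \<le> \<delta> * card A"
    and many: "16 * real t * m \<le> \<delta> * (\<mu> ^ (t - 2) * card A)"
    and few: "4 * real t ^ 5 * real \<Delta> < \<mu> ^ (t - 1) * card A"
  shows "\<exists>Q w. subdivision t Q w"
proof (rule ccontr)
  assume "\<not> ?thesis"
  then have nosub: "\<And>Q w. \<not> subdivision t Q w" by blast
  have tpos: "real t > 0" and t1: "t \<ge> 1" using assms(1) by auto
  then have "0 < 16 * real t * m" using B by simp
  then have ne: "A \<noteq> {}" using start by auto
  have "8 * real t * m \<le> \<delta> * card A" using start \<open>0 < 16 * real t * m\<close> by linarith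
  then obtain u where u: "u \<in> A" "\<delta>\<^sup>2 * card A / (8 * real t ^ 3 * m) \<le> card {v \<in> A. light t u v}"
    using light_degree_step[OF nosub t1 A ne B deg] by blast
  have "2 * \<mu> * card A = \<delta>\<^sup>2 * card A / (8 * real t ^ 3 * m)" by (simp add: \<mu>)
  also have "\<dots> \<le> card A" using u(2) card_mono[OF A, of "{v \<in> A. light t u v}"] by fastforce
  finally have "(2 * \<mu>) * real (card A) \<le> 1 * real (card A)" by simp
  moreover have "real (card A) > 0" using ne A by (simp add: card_gt_0_iff)
  ultimately have "2 * \<mu> \<le> 1" by simp
  moreover have \<mu>0: "0 \<le> \<mu>" using \<mu> B by simp
  ultimately have \<mu>1: "\<mu> \<le> 1" by simp
  have mono: "\<mu> ^ j * card A \<le> \<mu> ^ i * card A" if "i \<le> j" for i j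
    using power_decreasing[OF that \<mu>0 \<mu>1] by (intro mult_right_mono) auto
  have m: "16 * real t * m \<le> \<delta> * (\<mu> ^ i * card A)" if "i \<le> t - 2" for i
    using many mult_left_mono[OF mono[OF that], of \<delta>] deg(2) by linarith
  have f: "4 * real t ^ 5 * real \<Delta> \<le> \<mu> ^ i * card A" if "i \<le> t - 2" for i
  proof -
    have "i \<le> t - 1" using that by simp
    then show ?thesis using less_imp_le[OF few] order_trans mono by blast
  qed
  obtain Q U where Q: "finite Q" "card Q = t - 1" "separated Q"
    and U: "U \<subseteq> A" "\<mu> ^ (t - 1) * card A \<le> card U"
    and QU: "\<forall>p\<in>Q. \<forall>q\<in>Q \<union> U. p \<noteq> q \<longrightarrow> light t p q" "Q \<inter> U = {}"
    using light_nested_neighbourhoods[OF nosub assms(1) A B deg \<Delta> \<mu> m f, of "t - 1"] by auto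
  have "card (bad Q) \<le> 2 * t ^ 5 * \<Delta>"
    using Q QU by (intro card_bad_le \<Delta>) auto
  then have "real (card (bad Q)) \<le> real (2 * t ^ 5 * \<Delta>)" by (rule of_nat_mono)
  then have "real (card (bad Q)) \<le> 2 * real t ^ 5 * real \<Delta>" by simp
  also have "\<dots> \<le> 4 * real t ^ 5 * real \<Delta>" by simp
  also have "\<dots> < card U" using few U(2) by linarith
  finally have "card (bad Q) < card U" by simp
  moreover have "finite (bad Q)"
  proof -
    have "bad Q \<subseteq> fst ` F" by (force simp: bad_def)
    then show ?thesis using finite_F finite_subset by blast
  qed
  ultimately have "\<not> U \<subseteq> bad Q" by (meson card_mono not_less)
  then obtain v where v: "v \<in> U" "v \<notin> bad Q" by blast
  then have "v \<notin> Q" using QU(2) by blast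
  have "\<exists>w. subdivision t (insert v Q) w"
  proof (rule subdivision_of_separated)
    show "card (insert v Q) = t" using Q \<open>v \<notin> Q\<close> assms(1) by simp
    show "separated (insert v Q)" using Q v \<open>v \<notin> Q\<close> by (intro separated_insert)
    show "light t p q" if "p \<in> insert v Q" "q \<in> insert v Q" "p \<noteq> q" for p q
      using that QU(1) v(1) by (auto intro: light_sym)
  qed
  then show False using nosub by blast
qed

end

section \<open>Passing to a nearly regular pair\<close>

lemma conflict_graph_subset:
  assumes "conflict_graph F conf" "F' \<subseteq> F"
  shows "conflict_graph F' conf"
proof -
  interpret conflict_graph F conf by fact
  show ?thesis
  proof
    show "finite F'" using finite_F assms(2) finite_subset by blast
    show "card {w'. (a, w') \<in> F' \<and> conf w w'} \<le> 2" for a w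
    proof -
      have "card {w'. (a, w') \<in> F' \<and> conf w w'} \<le> card {w' \<in> nb {a}. conf w w'}"
        using assms(2) finite_nb[of "{a}"] by (intro card_mono) (auto simp: nb_def)
      also have "\<dots> \<le> 2" by (rule few_conf_nb) simp
      finally show ?thesis .
    qed
  qed (use conf_refl conf_sym nonconf assms(2) in blast)+
qed

lemma subdivision_mono:
  assumes "conflict_graph F conf" "F' \<subseteq> F" "conflict_graph.subdivision F' conf t Q w"
  shows "conflict_graph.subdivision F conf t Q w"
proof -
  interpret conflict_graph F conf by fact
  interpret sub: conflict_graph F' conf by (rule conflict_graph_subset[OF assms(1,2)])
  have "sub.nb e \<subseteq> nb e" for e using assms(2) by (auto simp: sub.nb_def nb_def)
  then show ?thesis using assms(3) unfolding sub.subdivision_def subdivision_def by blast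
qed

lemma card_strip:
  assumes "finite A" "finite S"
  shows "real (card (F \<inter> A \<times> S)) = (\<Sum>a\<in>A. real (card {b \<in> S. (a, b) \<in> F}))"
proof -
  have "F \<inter> A \<times> S = (SIGMA a:A. {b \<in> S. (a, b) \<in> F})" by auto
  then show ?thesis using assms by simp
qed

text \<open>
  Applied to a densest balanced pair: averaging over the \<open>card S\<close> vertices of \<open>A\<close> with most neighbours
  in \<open>S\<close> turns the density bound for balanced pairs into one for thin strips. This is what makes high
  degrees rare and low degrees harmless.
\<close>

lemma strip_le:
  fixes \<phi> \<epsilon> :: real
  assumes "finite A" "finite S" "card S \<le> card A"
    and dens: "\<And>A'. A' \<subseteq> A \<Longrightarrow> card A' = card S \<Longrightarrow>
      card (F \<inter> A' \<times> S) \<le> \<phi> * real (card S) powr (1 + \<epsilon>)"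
  shows "card (F \<inter> A \<times> S) \<le> \<phi> * card A * real (card S) powr \<epsilon>"
proof (cases "S = {}")
  case False
  define f where "f a = real (card {b \<in> S. (a, b) \<in> F})" for a
  obtain A' where A': "A' \<subseteq> A" "card A' = card S" "card S * sum f A \<le> card A * sum f A'"
    using heavy_subset[OF assms(1,3)] by blast
  have S: "real (card S) > 0" using False assms(2) by (simp add: card_gt_0_iff)
  have "sum f A' \<le> \<phi> * real (card S) powr (1 + \<epsilon>)"
    using dens[OF A'(1,2)] card_strip[of A' S F] finite_subset[OF A'(1) assms(1)] assms(2)
    by (simp add: f_def)
  then have "card A * sum f A' \<le> card A * (\<phi> * real (card S) powr (1 + \<epsilon>))"
    by (rule mult_left_mono) simp
  with A'(3) have "card S * sum f A \<le> card A * (\<phi> * real (card S) powr (1 + \<epsilon>))"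
    by (rule order_trans)
  also have "\<dots> = card S * (\<phi> * card A * real (card S) powr \<epsilon>)"
    using S by (simp add: powr_add)
  finally have "card S * sum f A \<le> card S * (\<phi> * card A * real (card S) powr \<epsilon>)" .
  then have "sum f A \<le> \<phi> * card A * real (card S) powr \<epsilon>"
    using S by simp
  then show ?thesis using card_strip[OF assms(1,2), of F] by (simp add: f_def)
qed simp

text \<open>
  The exponent \<open>1 + (t - 2) / (2 t - 3)\<close> enters here: the hypothesis on \<open>\<delta>\<close> is exactly what both the last
  shrinking step and the final removal of bad vertices require.
\<close>

lemma nested_neighbourhood_bounds:
  fixes \<delta> m a \<kappa> X G :: real
  assumes "t \<ge> 2" "G * m ^ (t - 2) \<le> \<delta> ^ (2 * t - 3)" "\<kappa> * m \<le> a"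
    and pos: "m > 0" "\<delta> > 0" "\<kappa> > 0" "X > 0"
  shows "\<kappa> * G / X ^ (t - 2) * m \<le> \<delta> * ((\<delta>\<^sup>2 / (X * m)) ^ (t - 2) * a)"
    and "\<kappa> * G / X ^ (t - 1) * \<delta> \<le> (\<delta>\<^sup>2 / (X * m)) ^ (t - 1) * a"
proof -
  obtain k where k: "t = k + 2" using assms(1) by (metis add.commute le_Suc_ex)
  define M where "M = \<delta>\<^sup>2 / (X * m)"
  have M: "0 < M" using pos by (simp add: M_def)
  have MX: "(X * m) ^ j * M ^ j = (\<delta>\<^sup>2) ^ j" for j
    using pos by (simp add: M_def flip: power_mult_distrib)
  have d: "G * m ^ k \<le> \<delta> * (\<delta>\<^sup>2) ^ k" 
  proof -
    have "2 * t - 3 = Suc (2 * k)" using k by simp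
    then show ?thesis using assms(2) k by (simp add: power_mult)
  qed
  have "\<kappa> * m * (G * m ^ k) \<le> \<kappa> * m * (\<delta> * ((X * m) ^ k * M ^ k))"
    using d pos unfolding MX by (intro mult_left_mono) auto
  then have "m ^ k * (\<kappa> * m * G) \<le> m ^ k * (\<kappa> * m * \<delta> * X ^ k * M ^ k)"
    by (simp add: power_mult_distrib mult_ac)
  then have 1: "\<kappa> * m * G \<le> \<kappa> * m * \<delta> * X ^ k * M ^ k" using pos by simp
  have "\<kappa> * G / X ^ k * m \<le> \<delta> * (M ^ k * (\<kappa> * m))"
    using 1 pos by (simp add: field_simps)
  also have "\<dots> \<le> \<delta> * (M ^ k * a)"
    using assms(3) pos M by (intro mult_left_mono) auto
  finally show "\<kappa> * G / X ^ (t - 2) * m \<le> \<delta> * ((\<delta>\<^sup>2 / (X * m)) ^ (t - 2) * a)"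
    by (simp add: k M_def)
  have "\<kappa> * G \<le> \<kappa> * \<delta> * X ^ k * M ^ k" using 1 pos by (simp add: mult_ac)
  then have "\<delta> * (\<kappa> * G) \<le> \<delta> * (\<kappa> * \<delta> * X ^ k * M ^ k)" using pos by (intro mult_left_mono) auto
  also have "\<dots> = \<delta>\<^sup>2 * (\<kappa> * X ^ k * M ^ k)" by (simp add: power2_eq_square mult_ac)
  \<comment> \<open>Trading a further \<open>\<delta>\<^sup>2\<close> for a factor \<open>M\<close>
    leads to the second bound from the same inequality as the first.\<close>
  also have "\<delta>\<^sup>2 = X * m * M" using pos by (simp add: M_def)
  finally have "\<kappa> * G * \<delta> \<le> X ^ Suc k * (M ^ Suc k * (\<kappa> * m))" by (simp add: mult_ac)
  then have "\<kappa> * G / X ^ Suc k * \<delta> \<le> M ^ Suc k * (\<kappa> * m)"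
    using pos by (simp add: field_simps)
  also have "\<dots> \<le> M ^ Suc k * a" using assms(3) M by (intro mult_left_mono) auto
  finally show "\<kappa> * G / X ^ (t - 1) * \<delta> \<le> (\<delta>\<^sup>2 / (X * m)) ^ (t - 1) * a"
    by (simp add: k M_def)
qed

text \<open>At most \<open>card A / 2 powr (1 / \<epsilon>)\<close> vertices of \<open>B\<close>
  exceed the average degree by the factor \<open>2 powr (1 / \<epsilon>)\<close>, and by
  \<open>strip_le\<close> they meet at most half of the edges. Vertices of \<open>A\<close> with few
  neighbours in the rest meet at most a quarter. The surviving quarter lies in a strip over
  \<open>A1\<close>, and \<open>strip_le\<close> for \<open>F\<inverse>\<close> keeps
  \<open>A1\<close> from being small.\<close>

lemma dense_regular_pair:
  fixes \<phi> \<epsilon> :: real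
  assumes fin: "finite A" "finite B" "card A = card B" "A \<noteq> {}" and F: "finite F" "F \<subseteq> A \<times> B"
    and \<epsilon>: "\<epsilon> > 0" and e: "\<phi> * real (card A) powr (1 + \<epsilon>) = card F" "\<phi> > 0"
    and dens: "\<And>A' B'. A' \<subseteq> A \<Longrightarrow> B' \<subseteq> B \<Longrightarrow> card A' = card B' \<Longrightarrow>
      card (F \<inter> A' \<times> B') \<le> \<phi> * real (card A') powr (1 + \<epsilon>)"
  shows "\<exists>A1\<subseteq>A. \<exists>B1\<subseteq>B. 4 powr (- 1 / \<epsilon>) * card A \<le> card A1 \<and>
    (\<forall>a\<in>A1. \<phi> * real (card A) powr \<epsilon> / 4 \<le> card {b \<in> B1. (a, b) \<in> F}) \<and>
    (\<forall>b\<in>B1. card {a \<in> A. (a, b) \<in> F} \<le> 2 powr (1 / \<epsilon>) * \<phi> * real (card A) powr \<epsilon>)"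
proof -
  define m where "m = real (card A)"
  define K where "K = 2 powr (1 / \<epsilon>)"
  have m: "m > 0" using fin(1,4) by (simp add: m_def card_gt_0_iff)
  have K: "K > 0" "K powr \<epsilon> = 2" using \<epsilon> by (auto simp: K_def powr_powr)
  have mm: "m powr (1 + \<epsilon>) = m * m powr \<epsilon>" using m by (simp add: powr_add)
  have eF: "card F = \<phi> * m * m powr \<epsilon>" using e(1) mm by (simp add: m_def)
  have mono: "card (F \<inter> X) \<le> card (F \<inter> Y)" if "X \<subseteq> Y" for X Y
    using that F(1) by (intro card_mono) auto
  have stripB: "card (F \<inter> A \<times> S) \<le> \<phi> * m * real (card S) powr \<epsilon>" if "S \<subseteq> B" for S
    unfolding m_def
  proof (rule strip_le[OF fin(1)])
    show "finite S" "card S \<le> card A" using that fin finite_subset card_mono by metis+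
  qed (use dens that in metis)
  have stripA: "card (F \<inter> S \<times> B) \<le> \<phi> * m * real (card S) powr \<epsilon>" if "S \<subseteq> A" for S
  proof -
    have sw: "card (F \<inter> S \<times> B') = card (F\<inverse> \<inter> B' \<times> S)" for B'
    proof -
      have "F\<inverse> \<inter> B' \<times> S = (F \<inter> S \<times> B')\<inverse>" by auto
      then show ?thesis by simp
    qed
    have "card (F\<inverse> \<inter> B \<times> S) \<le> \<phi> * card B * real (card S) powr \<epsilon>"
    proof (rule strip_le[OF fin(2)])
      show "finite S" "card S \<le> card B" using that fin finite_subset card_mono by metis+
    qed (use dens[OF that] sw in metis)
    then show ?thesis using sw fin(3) by (simp add: m_def)
  qed
  define S where "S = {b \<in> B. K * \<phi> * m powr \<epsilon> < card {a \<in> A. (a, b) \<in> F}}"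
  have S: "S \<subseteq> B" "finite S" using fin by (auto simp: S_def)
  have deg_sum: "real (card (F \<inter> A \<times> S)) = (\<Sum>b\<in>S. real (card {a \<in> A. (a, b) \<in> F}))"
  proof -
    have "F \<inter> A \<times> S = (SIGMA b:S. {a \<in> A. (a, b) \<in> F})\<inverse>" by auto
    then show ?thesis using S(2) fin(1) by simp
  qed
  have "card S * (K * \<phi> * m powr \<epsilon>) \<le> (\<Sum>b\<in>S. real (card {a \<in> A. (a, b) \<in> F}))"
    by (rule sum_bounded_below) (auto simp: S_def)
  also have "\<dots> \<le> card F" unfolding deg_sum[symmetric] using F(1) by (simp add: card_mono)
  also have "\<dots> = m * (\<phi> * m powr \<epsilon>)" using eF by simp
  finally have "(K * card S) * (\<phi> * m powr \<epsilon>) \<le> m * (\<phi> * m powr \<epsilon>)" by (simp add: mult_ac)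
  then have "K * card S \<le> m" using e(2) m by simp
  then have "(K * card S) powr \<epsilon> \<le> m powr \<epsilon>" using K \<epsilon> by (intro powr_mono2) auto
  then have "2 * real (card S) powr \<epsilon> \<le> m powr \<epsilon>" using K by (simp add: powr_mult)
  then have "\<phi> * m * (2 * real (card S) powr \<epsilon>) \<le> \<phi> * m * m powr \<epsilon>"
    using e(2) m by (intro mult_left_mono) auto
  then have eS: "2 * real (card (F \<inter> A \<times> S)) \<le> card F"
    using stripB[OF S(1)] eF by simp
  define B1 where "B1 = B - S"
  define A1 where "A1 = {a \<in> A. \<phi> * m powr \<epsilon> / 4 \<le> card {b \<in> B1. (a, b) \<in> F}}"
  have sub: "A1 \<subseteq> A" "B1 \<subseteq> B" "finite B1" using fin by (auto simp: A1_def B1_def)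
  have "card F \<le> card (((F \<inter> A \<times> S) \<union> (F \<inter> (A - A1) \<times> B1)) \<union> (F \<inter> A1 \<times> B1))"
    using F sub by (intro card_mono) (auto simp: B1_def)
  also have "\<dots> \<le> card ((F \<inter> A \<times> S) \<union> (F \<inter> (A - A1) \<times> B1)) + card (F \<inter> A1 \<times> B1)"
    by (rule card_Un_le)
  also have "\<dots> \<le> card (F \<inter> A \<times> S) + card (F \<inter> (A - A1) \<times> B1) + card (F \<inter> A1 \<times> B1)"
    by (intro add_right_mono card_Un_le)
  finally have "card F \<le> card (F \<inter> A \<times> S) + card (F \<inter> (A - A1) \<times> B1) + card (F \<inter> A1 \<times> B1)" .
  moreover have "card (F \<inter> (A - A1) \<times> B1) \<le> card F / 4"
  proof -
    have "real (card (F \<inter> (A - A1) \<times> B1)) = (\<Sum>a\<in>A - A1. real (card {b \<in> B1. (a, b) \<in> F}))"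
      using fin sub by (intro card_strip) auto
    also have "\<dots> \<le> card (A - A1) * (\<phi> * m powr \<epsilon> / 4)"
      by (rule sum_bounded_above) (auto simp: A1_def)
    also have "\<dots> \<le> m * (\<phi> * m powr \<epsilon> / 4)"
      using card_mono[OF fin(1), of "A - A1"] e(2) unfolding m_def by (intro mult_right_mono) auto
    finally show ?thesis using eF by (simp add: mult_ac)
  qed
  ultimately have "card F / 4 \<le> card (F \<inter> A1 \<times> B1)" using eS by linarith
  also have "\<dots> \<le> card (F \<inter> A1 \<times> B)" using mono[of "A1 \<times> B1" "A1 \<times> B"] sub by auto
  also have "\<dots> \<le> \<phi> * m * real (card A1) powr \<epsilon>" by (rule stripA[OF sub(1)])
  finally have "\<phi> * m * (m powr \<epsilon>) \<le> \<phi> * m * (4 * real (card A1) powr \<epsilon>)" using eF by simp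
  then have "m powr \<epsilon> \<le> 4 * real (card A1) powr \<epsilon>" using e(2) m by simp
  then have "(m powr \<epsilon>) powr (1 / \<epsilon>) \<le> (4 * real (card A1) powr \<epsilon>) powr (1 / \<epsilon>)"
    using \<epsilon> by (intro powr_mono2) auto
  then have "m \<le> 4 powr (1 / \<epsilon>) * card A1" using \<epsilon> m by (simp add: powr_mult powr_powr)
  then have "4 powr (- 1 / \<epsilon>) * m \<le> 4 powr (- 1 / \<epsilon>) * (4 powr (1 / \<epsilon>) * card A1)"
    by (intro mult_left_mono) auto
  also have "\<dots> = card A1" by (simp flip: mult.assoc powr_add)
  finally have "4 powr (- 1 / \<epsilon>) * m \<le> card A1" .
  moreover have "card {a \<in> A. (a, b) \<in> F} \<le> K * \<phi> * m powr \<epsilon>" if "b \<in> B1" for b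
    using that by (auto simp: B1_def S_def)
  ultimately show ?thesis using sub unfolding m_def K_def A1_def by blast
qed

text \<open>Comparison with \<open>A\<close>, \<open>B\<close> carries the density hypothesis over
  to the maximiser, and maximality bounds the edges of all its balanced sub-pairs. \<open>A0\<close>
  may be much smaller than \<open>A\<close>; the later estimates depend on the ratio alone.\<close>

lemma densest_balanced_pair:
  fixes F :: "('a \<times> 'b) set" and \<alpha> :: real
  assumes "finite A" "finite B" "card A = card B" "A \<noteq> {}"
  obtains A0 B0 where "A0 \<subseteq> A" "B0 \<subseteq> B" "card A0 = card B0" "A0 \<noteq> {}"
    and "card (F \<inter> A \<times> B) / real (card A) powr \<alpha> \<le> card (F \<inter> A0 \<times> B0) / real (card A0) powr \<alpha>"
    and "\<forall>A'\<subseteq>A0. \<forall>B'\<subseteq>B0. card A' = card B' \<longrightarrow> A' \<noteq> {} \<longrightarrow>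
      card (F \<inter> A' \<times> B') / real (card A') powr \<alpha> \<le> card (F \<inter> A0 \<times> B0) / real (card A0) powr \<alpha>"
proof -
  define Z where "Z = {(A', B'). A' \<subseteq> A \<and> B' \<subseteq> B \<and> card A' = card B' \<and> A' \<noteq> {}}"
  define g where "g z = card (F \<inter> fst z \<times> snd z) / real (card (fst z)) powr \<alpha>" for z :: "'a set \<times> 'b set"
  have "finite Z"
    by (rule finite_subset[of _ "Pow A \<times> Pow B"]) (use assms in \<open>auto simp: Z_def\<close>)
  moreover have AB: "(A, B) \<in> Z" using assms by (simp add: Z_def)
  ultimately have "finite (g ` Z)" "g ` Z \<noteq> {}" by auto
  then have "Max (g ` Z) \<in> g ` Z" "\<And>z. z \<in> Z \<Longrightarrow> g z \<le> Max (g ` Z)" by auto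
  then obtain z where z: "z \<in> Z" "\<And>y. y \<in> Z \<Longrightarrow> g y \<le> g z" by auto
  obtain A0 B0 where "z = (A0, B0)" by fastforce
  then have *: "A0 \<subseteq> A" "B0 \<subseteq> B" "card A0 = card B0" "A0 \<noteq> {}"
    and max: "\<And>A' B'. (A', B') \<in> Z \<Longrightarrow> g (A', B') \<le> g (A0, B0)"
    using z by (auto simp: Z_def)
  have "g (A', B') \<le> g (A0, B0)"
    if "A' \<subseteq> A0" "B' \<subseteq> B0" "card A' = card B'" "A' \<noteq> {}" for A' B'
    using that * by (intro max) (auto simp: Z_def)
  then have "\<forall>A'\<subseteq>A0. \<forall>B'\<subseteq>B0. card A' = card B' \<longrightarrow> A' \<noteq> {} \<longrightarrow> g (A', B') \<le> g (A0, B0)"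
    by blast
  with * max[OF AB] show ?thesis unfolding g_def fst_conv snd_conv by (rule that)
qed

section \<open>Subdivisions in dense conflict graphs\<close>

text \<open>\<open>t \<ge> 3\<close> makes \<open>\<epsilon>\<close> positive, as the constants with
  exponent \<open>1 / \<epsilon>\<close> in the regularisation require.\<close>

lemma dense_conflict_graph_subdivision:
  fixes t :: nat
  assumes "t \<ge> 3"
  shows "\<exists>C>0. \<forall>(F :: ('a \<times> 'b) set) conf A B. conflict_graph F conf \<longrightarrow> F \<subseteq> A \<times> B \<longrightarrow>
    finite A \<longrightarrow> finite B \<longrightarrow> card A = card B \<longrightarrow>
    C * real (card A) powr (1 + (real t - 2) / (2 * real t - 3)) < card F \<longrightarrow>
    (\<exists>Q w. conflict_graph.subdivision F conf t Q w)"
proof -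
  define \<epsilon> where "\<epsilon> = (real t - 2) / (2 * real t - 3)"
  have \<epsilon>: "\<epsilon> > 0" "\<epsilon> * real (2 * t - 3) = real (t - 2)"
    using assms by (auto simp: \<epsilon>_def of_nat_diff)
  define \<kappa> where "\<kappa> = 4 powr (- 1 / \<epsilon>)"
  define K where "K = 2 powr (1 / \<epsilon>)"
  define X where "X = 16 * real t ^ 3"
  \<comment> \<open>The three summands provide, in order, the hypotheses \<open>start\<close>,
    \<open>many\<close> and \<open>few\<close> of \<open>subdivision_of_regular\<close>; the final 1
    makes \<open>few\<close> strict.\<close>
  define G where "G = (16 * real t + 16 * real t * X ^ (t - 2) + (16 * K * real t ^ 5 * X ^ (t - 1) + 1)) / \<kappa>"
  have pos: "\<kappa> > 0" "K > 0" "X > 0" using assms by (auto simp: \<kappa>_def K_def X_def)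
  have \<kappa>1: "\<kappa> \<le> 1" unfolding \<kappa>_def using \<epsilon> powr_mono[of "- 1 / \<epsilon>" 0 4] by simp
  have nn: "0 \<le> 16 * real t * X ^ (t - 2)" "0 \<le> 16 * K * real t ^ 5 * X ^ (t - 1)"
    using pos by auto
  have \<kappa>G: "\<kappa> * G = 16 * real t + 16 * real t * X ^ (t - 2) + (16 * K * real t ^ 5 * X ^ (t - 1) + 1)"
    using pos by (simp add: G_def)
  have G0: "0 < G" unfolding G_def using pos nn by (intro divide_pos_pos) linarith+
  have "1 \<le> \<kappa> * G" using \<kappa>G nn by linarith
  also have "\<dots> \<le> 1 * G" using \<kappa>1 G0 by (intro mult_right_mono) auto
  finally have G1: "1 \<le> G" by simp
  show ?thesis
  proof (intro exI[of _ "4 * G"] conjI allI impI)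
    show "0 < 4 * G" using G0 by simp
    fix F :: "('a \<times> 'b) set" and conf A B
    assume cg: "conflict_graph F conf" and FAB: "F \<subseteq> A \<times> B" and fin: "finite A" "finite B" "card A = card B"
      and big: "4 * G * real (card A) powr (1 + (real t - 2) / (2 * real t - 3)) < card F"
    have fF: "finite F" using FAB fin finite_subset by blast
    have A: "A \<noteq> {}" using FAB big by auto
    then have cA: "real (card A) > 0" using fin(1) by (simp add: card_gt_0_iff)
    have FA: "F \<inter> A \<times> B = F" using FAB by blast
    obtain A0 B0 where AB0: "A0 \<subseteq> A" "B0 \<subseteq> B" "card A0 = card B0" "A0 \<noteq> {}"
      and ge: "card F / real (card A) powr (1 + \<epsilon>) \<le> card (F \<inter> A0 \<times> B0) / real (card A0) powr (1 + \<epsilon>)"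
      and max: "\<forall>A'\<subseteq>A0. \<forall>B'\<subseteq>B0. card A' = card B' \<longrightarrow> A' \<noteq> {} \<longrightarrow>
        card (F \<inter> A' \<times> B') / real (card A') powr (1 + \<epsilon>) \<le> card (F \<inter> A0 \<times> B0) / real (card A0) powr (1 + \<epsilon>)"
      by (rule densest_balanced_pair[OF fin A, of F "1 + \<epsilon>", unfolded FA]) (rule that)
    define \<phi> where "\<phi> = card (F \<inter> A0 \<times> B0) / real (card A0) powr (1 + \<epsilon>)"
    define m where "m = real (card A0)"
    have fin0: "finite A0" "finite B0" using AB0 fin finite_subset by auto
    have m1: "m \<ge> 1" using AB0(4) fin0 by (simp add: m_def Suc_leI card_gt_0_iff)
    have "4 * G < card F / real (card A) powr (1 + \<epsilon>)"
      using big cA by (simp add: \<epsilon>_def pos_less_divide_eq)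
    with ge have \<phi>G: "4 * G < \<phi>" unfolding \<phi>_def by linarith
    then have \<phi>0: "\<phi> > 0" using G0 by linarith
    define F0 where "F0 = F \<inter> A0 \<times> B0"
    have F0: "finite F0" "F0 \<subseteq> A0 \<times> B0" using fF by (auto simp: F0_def)
    have "\<exists>A1\<subseteq>A0. \<exists>B1\<subseteq>B0. 4 powr (- 1 / \<epsilon>) * card A0 \<le> card A1 \<and>
      (\<forall>a\<in>A1. \<phi> * real (card A0) powr \<epsilon> / 4 \<le> card {b \<in> B1. (a, b) \<in> F0}) \<and>
      (\<forall>b\<in>B1. card {a \<in> A0. (a, b) \<in> F0} \<le> 2 powr (1 / \<epsilon>) * \<phi> * real (card A0) powr \<epsilon>)"
    proof (rule dense_regular_pair[OF fin0 AB0(3,4) F0 \<epsilon>(1) _ \<phi>0])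
      show "\<phi> * real (card A0) powr (1 + \<epsilon>) = card F0"
        using m1 by (simp add: \<phi>_def F0_def m_def)
      fix A' B' assume *: "A' \<subseteq> A0" "B' \<subseteq> B0" "card A' = card B'"
      have F0': "F0 \<inter> A' \<times> B' = F \<inter> A' \<times> B'" using * by (auto simp: F0_def)
      show "card (F0 \<inter> A' \<times> B') \<le> \<phi> * real (card A') powr (1 + \<epsilon>)"
      proof (cases "A' = {}")
        case False
        moreover have "finite A'" using * fin0 finite_subset by blast
        ultimately have "real (card A') powr (1 + \<epsilon>) > 0" by (simp add: card_gt_0_iff)
        then show ?thesis using max[rule_format, OF * False] unfolding F0' \<phi>_def[symmetric]
          by (simp add: pos_divide_le_eq)
      qed simp
    qed
    then obtain A1 B1 where AB1: "A1 \<subseteq> A0" "B1 \<subseteq> B0" and a1: "\<kappa> * m \<le> card A1"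
      and deg: "\<And>a. a \<in> A1 \<Longrightarrow> \<phi> * m powr \<epsilon> / 4 \<le> card {b \<in> B1. (a, b) \<in> F0}"
      and Deg: "\<And>b. b \<in> B1 \<Longrightarrow> card {a \<in> A0. (a, b) \<in> F0} \<le> K * \<phi> * m powr \<epsilon>"
      unfolding \<kappa>_def K_def m_def by blast
    \<comment> \<open>The minimum degree on the side of \<open>A1\<close>. In terms of
      \<open>\<delta>\<close> the maximum degree on the side of \<open>B1\<close> is at most
      \<open>4 * K * \<delta>\<close>.\<close>
    define \<delta> where "\<delta> = \<phi> * m powr \<epsilon> / 4"
    have meps: "m powr \<epsilon> \<ge> 1" using m1 \<epsilon>(1) by (simp add: ge_one_powr_ge_zero)
    have "G * 1 \<le> \<phi> / 4 * m powr \<epsilon>" using \<phi>G G0 meps by (intro mult_mono) auto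
    then have \<delta>G: "G \<le> \<delta>" by (simp add: \<delta>_def)
    then have \<delta>0: "\<delta> > 0" using G0 by linarith
    have t3: "2 * t - 3 > 0" using assms by simp
    have "G * m ^ (t - 2) \<le> \<delta> ^ (2 * t - 3)"
    proof -
      have "(m powr \<epsilon>) ^ (2 * t - 3) = m ^ (t - 2)"
        using m1 \<epsilon>(2) by (simp add: powr_powr flip: powr_realpow)
      then have "\<delta> ^ (2 * t - 3) = (\<phi> / 4) ^ (2 * t - 3) * m ^ (t - 2)"
        by (simp add: \<delta>_def power_mult_distrib power_divide)
      moreover have "G \<le> (\<phi> / 4) ^ (2 * t - 3)"
        using \<phi>G G1 self_le_power[of "\<phi> / 4" "2 * t - 3"] t3 by linarith
      ultimately show ?thesis using m1 by (simp add: mult_right_mono)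
    qed
    note bounds = nested_neighbourhood_bounds[OF _ this a1 _ \<delta>0 pos(1,3)]
    have t2: "t \<ge> 2" and mp: "m > 0" using assms m1 by auto
    define F1 where "F1 = F0 \<inter> A1 \<times> B1"
    have F1F: "F1 \<subseteq> F" by (auto simp: F1_def F0_def)
    interpret F1: conflict_graph F1 conf by (rule conflict_graph_subset[OF cg F1F])
    have "\<exists>Q w. F1.subdivision t Q w"
    proof (rule F1.subdivision_of_regular[OF t2])
      show "finite A1" "finite B1" using AB1 fin0 finite_subset by auto
      show "F1 \<subseteq> UNIV \<times> B1" by (auto simp: F1_def)
      show "real (card B1) \<le> m" using AB1 fin0 AB0(3) by (simp add: m_def card_mono)
      show "0 < m" "0 < \<delta>" by fact+
      show "\<delta> \<le> card (F1.nb {u})" if "u \<in> A1" for u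
      proof -
        have "F1.nb {u} = {b \<in> B1. (u, b) \<in> F0}"
          unfolding F1.nb_def using that by (auto simp: F1_def)
        then show ?thesis using deg[OF that] by (simp add: \<delta>_def)
      qed
      show "card {a. (a, b) \<in> F1} \<le> nat \<lfloor>4 * K * \<delta>\<rfloor>" for b
      proof (cases "b \<in> B1")
        case True
        have "card {a. (a, b) \<in> F1} \<le> card {a \<in> A0. (a, b) \<in> F0}"
          using fin0 by (intro card_mono) (auto simp: F1_def F0_def)
        also have "real \<dots> \<le> 4 * K * \<delta>" using Deg[OF True] by (simp add: \<delta>_def)
        finally show ?thesis using le_nat_floor by simp
      qed (simp add: F1_def)
      show "\<delta>\<^sup>2 / (X * m) = \<delta>\<^sup>2 / (16 * real t ^ 3 * m)" by (simp add: X_def)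
      have "16 * real t \<le> \<kappa> * G" using \<kappa>G nn by linarith
      also have "\<dots> \<le> \<kappa> * \<delta>" using \<delta>G pos by simp
      finally have "16 * real t * m \<le> \<kappa> * \<delta> * m" using mp by simp
      also have "\<dots> \<le> \<delta> * card A1" using mult_left_mono[OF a1, of \<delta>] \<delta>0 by (simp add: mult_ac)
      finally show "16 * real t * m \<le> \<delta> * card A1" .
      have "16 * real t * X ^ (t - 2) \<le> \<kappa> * G" using \<kappa>G nn by linarith
      then have "16 * real t \<le> \<kappa> * G / X ^ (t - 2)" using pos by (simp add: pos_le_divide_eq)
      then have "16 * real t * m \<le> \<kappa> * G / X ^ (t - 2) * m" using mp by (intro mult_right_mono) auto
      also note bounds(1)[OF t2 mp]
      finally show "16 * real t * m \<le> \<delta> * ((\<delta>\<^sup>2 / (X * m)) ^ (t - 2) * card A1)" .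
      have "16 * K * real t ^ 5 * X ^ (t - 1) < \<kappa> * G" using \<kappa>G nn by linarith
      then have "16 * K * real t ^ 5 < \<kappa> * G / X ^ (t - 1)" using pos by (simp add: pos_less_divide_eq)
      then have *: "16 * K * real t ^ 5 * \<delta> < \<kappa> * G / X ^ (t - 1) * \<delta>" using \<delta>0 by (intro mult_strict_right_mono) auto
      have "real (nat \<lfloor>4 * K * \<delta>\<rfloor>) \<le> 4 * K * \<delta>" using pos \<delta>0 by simp
      then have "4 * real t ^ 5 * real (nat \<lfloor>4 * K * \<delta>\<rfloor>) \<le> 4 * real t ^ 5 * (4 * K * \<delta>)"
        by (intro mult_left_mono) auto
      also have "\<dots> = 16 * K * real t ^ 5 * \<delta>" by simp
      also note *
      also note bounds(2)[OF t2 mp]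
      finally show "4 * real t ^ 5 * real (nat \<lfloor>4 * K * \<delta>\<rfloor>) < (\<delta>\<^sup>2 / (X * m)) ^ (t - 1) * card A1" .
    qed
    then show "\<exists>Q w. conflict_graph.subdivision F conf t Q w"
      using subdivision_mono[OF cg F1F] by blast
  qed
qed

text \<open>For \<open>t = 2\<close> the subdivided graph is a path with two edges and the exponent
  of the density bound is 1, so the pigeonhole principle on \<open>B\<close> suffices.\<close>

lemma path_in_conflict_graph:
  assumes "conflict_graph F conf" "F \<subseteq> A \<times> B" "finite A" "finite B" "card B < card F"
  shows "\<exists>Q w. conflict_graph.subdivision F conf 2 Q w"
proof -
  interpret conflict_graph F conf by fact
  have "\<not> inj_on snd F"
  proof
    assume "inj_on snd F"
    then have "card F \<le> card B"
      using assms(2,4) by (intro card_inj_on_le[of snd]) auto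
    then show False using assms(5) by simp
  qed
  then obtain p q b where pq: "(p, b) \<in> F" "(q, b) \<in> F" "p \<noteq> q" by (fastforce simp: inj_on_def)
  have e: "e = {p, q}" if "e \<subseteq> {p, q}" "card e = 2" for e
    using that pq(3) by (intro card_subset_eq) auto
  have "subdivision 2 {p, q} (\<lambda>_. b)"
    unfolding subdivision_def using pq e by (auto simp: nb_def)
  then show ?thesis by blast
qed

lemma conflict_graph_subdivision:
  fixes t :: nat
  assumes "t \<ge> 2"
  shows "\<exists>C>0. \<forall>(F :: ('a \<times> 'b) set) conf A B. conflict_graph F conf \<longrightarrow> F \<subseteq> A \<times> B \<longrightarrow>
    finite A \<longrightarrow> finite B \<longrightarrow> card A = card B \<longrightarrow>
    C * real (card A) powr (1 + (real t - 2) / (2 * real t - 3)) < card F \<longrightarrow>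
    (\<exists>Q w. conflict_graph.subdivision F conf t Q w)"
proof (cases "t = 2")
  case True
  show ?thesis
    by (intro exI[of _ 1]) (use path_in_conflict_graph True in auto)
next
  case False
  with assms have "t \<ge> 3" by simp
  then show ?thesis by (rule dense_conflict_graph_subdivision)
qed

section \<open>Colour repetitions\<close>

text \<open>
  Stated with \<open>r\<close> on the right because the truncated difference \<open>a * r - r\<close> is awkward to use; in the
  application \<open>r = t * (t - 1)\<close>.
\<close>

definition repeat_bounded :: "(nat \<times> nat \<Rightarrow> nat) \<Rightarrow> nat \<Rightarrow> nat \<Rightarrow> nat \<Rightarrow> bool" where
  "repeat_bounded d n a r \<longleftrightarrow> (\<forall>A B. A \<subseteq> {..<n} \<longrightarrow> B \<subseteq> {..<n} \<longrightarrow> card A = a \<longrightarrow> card B = r \<longrightarrow>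
     a * r < card (d ` (A \<times> B)) + r)"

text \<open>The part of size \<open>a\<close> may lie on either side. The second form gives
  \<open>repeat_bounded\<close> for the transposed colouring, which controls stars centred on the
  right.\<close>

lemma complete_bipartite_subgraph_colors:
  assumes "Hq_coloring (complete_bipartite n n) (complete_bipartite a b) q c"
    and AB: "A \<subseteq> {..<n}" "B \<subseteq> {..<n}" "card A = a" "card B = b"
  shows "q \<le> card ((\<lambda>(i, j). c {Inl i, Inr j}) ` (A \<times> B))"
    and "q \<le> card ((\<lambda>(i, j). c {Inl j, Inr i}) ` (A \<times> B))"
proof -
  have fin: "finite A" "finite B" using AB finite_subset by auto
  obtain g where g: "bij_betw g A {..<a}"
    using ex_bij_betw_finite_nat[OF fin(1)] AB(3) by (auto simp: atLeast0LessThan)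
  obtain h where h: "bij_betw h B {..<b}"
    using ex_bij_betw_finite_nat[OF fin(2)] AB(4) by (auto simp: atLeast0LessThan)
  have gh: "g ` A = {..<a}" "inj_on g A" "h ` B = {..<b}" "inj_on h B"
    using g h by (auto simp: bij_betw_def)
  have gA: "g i < a" if "i \<in> A" for i using g that by (auto simp: bij_betw_def)
  have hB: "h j < b" if "j \<in> B" for j using h that by (auto simp: bij_betw_def)
  define S :: "(nat + nat) ugraph" where
    "S = \<lparr>verts = A <+> B, edges = {{Inl i, Inr j} | i j. i \<in> A \<and> j \<in> B}\<rparr>"
  define f where "f = map_sum g h"
  have "f ` (A <+> B) = Inl ` (g ` A) \<union> Inr ` (h ` B)"
    by (simp add: f_def Plus_def image_Un image_image)
  then have "f ` (A <+> B) = {..<a} <+> {..<b}" by (simp add: gh Plus_def)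
  moreover have "inj_on f (A <+> B)"
    by (rule inj_onI) (auto simp: f_def dest: inj_onD[OF gh(2)] inj_onD[OF gh(4)])
  ultimately have "bij_betw f (A <+> B) ({..<a} <+> {..<b})" by (simp add: bij_betw_def)
  moreover have "{u, v} \<in> edges S \<longleftrightarrow> {f u, f v} \<in> edges (complete_bipartite a b)"
    if "u \<in> A <+> B" "v \<in> A <+> B" for u v
    using that gA hB by (cases u; cases v) (auto simp: S_def f_def complete_bipartite_def doubleton_eq_iff)
  ultimately have "graph_iso S (complete_bipartite a b)"
    unfolding graph_iso_def by (intro exI[of _ f]) (auto simp: S_def complete_bipartite_def)
  moreover have "subgraph_of S (complete_bipartite n n)"
    using AB(1,2) by (auto simp: subgraph_of_def simple_graph_def S_def complete_bipartite_def)
  ultimately have "q \<le> card (c ` edges S)" using assms(1) by (simp add: Hq_coloring_def)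
  also have "c ` edges S = (\<lambda>(i, j). c {Inl i, Inr j}) ` (A \<times> B)"
    by (auto simp: S_def)
  finally show "q \<le> card ((\<lambda>(i, j). c {Inl i, Inr j}) ` (A \<times> B))" .
  define S' :: "(nat + nat) ugraph" where
    "S' = \<lparr>verts = B <+> A, edges = {{Inl j, Inr i} | i j. i \<in> A \<and> j \<in> B}\<rparr>"
  define f' where "f' = case_sum (Inr \<circ> h) (Inl \<circ> g)"
  have "f' ` (B <+> A) = Inr ` (h ` B) \<union> Inl ` (g ` A)"
    by (simp add: f'_def Plus_def image_Un image_image)
  then have "f' ` (B <+> A) = {..<a} <+> {..<b}" by (simp add: gh Plus_def Un_commute)
  moreover have "inj_on f' (B <+> A)"
    by (rule inj_onI) (auto simp: f'_def dest: inj_onD[OF gh(2)] inj_onD[OF gh(4)])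
  ultimately have "bij_betw f' (B <+> A) ({..<a} <+> {..<b})" by (simp add: bij_betw_def)
  moreover have "{u, v} \<in> edges S' \<longleftrightarrow> {f' u, f' v} \<in> edges (complete_bipartite a b)"
    if "u \<in> B <+> A" "v \<in> B <+> A" for u v
    using that gA hB by (cases u; cases v) (auto simp: S'_def f'_def complete_bipartite_def doubleton_eq_iff)
  ultimately have "graph_iso S' (complete_bipartite a b)"
    unfolding graph_iso_def by (intro exI[of _ f']) (auto simp: S'_def complete_bipartite_def)
  moreover have "subgraph_of S' (complete_bipartite n n)"
    using AB(1,2) by (auto simp: subgraph_of_def simple_graph_def S'_def complete_bipartite_def)
  ultimately have "q \<le> card (c ` edges S')" using assms(1) by (simp add: Hq_coloring_def)
  also have "c ` edges S' = (\<lambda>(i, j). c {Inl j, Inr i}) ` (A \<times> B)"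
    by (auto simp: S'_def)
  finally show "q \<le> card ((\<lambda>(i, j). c {Inl j, Inr i}) ` (A \<times> B))" .
qed

section \<open>Redundant cells and monochromatic stars\<close>

text \<open>Deleting \<open>R\<close> loses no colour, since each of its colours recurs outside; so
  \<open>A \<times> B\<close>, enlarged to sizes exactly \<open>a\<close> and \<open>r\<close>,
  shows at most \<open>a * r - card R\<close> colours. \<open>a \<le> n\<close> and
  \<open>r \<le> n\<close> make room for the enlargement.\<close>

lemma no_redundant_cells:
  assumes "repeat_bounded d n a r" "a \<le> n" "r \<le> n"
    and A: "A \<subseteq> {..<n}" "card A \<le> a" and B: "B \<subseteq> {..<n}" "card B \<le> r"
    and R: "R \<subseteq> A \<times> B" "r \<le> card R" "\<And>x. x \<in> R \<Longrightarrow> \<exists>y\<in>A \<times> B - R. d x = d y"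
  shows False
proof -
  obtain A' where A': "A \<subseteq> A'" "A' \<subseteq> {..<n}" "card A' = a"
    using exists_subset_between[of A a "{..<n}"] A assms(2) by auto
  obtain B' where B': "B \<subseteq> B'" "B' \<subseteq> {..<n}" "card B' = r"
    using exists_subset_between[of B r "{..<n}"] B assms(3) by auto
  have fin: "finite A'" "finite B'" using finite_subset[OF A'(2)] finite_subset[OF B'(2)] by auto
  have sub: "A \<times> B \<subseteq> A' \<times> B'" using A' B' by auto
  have fR: "finite R" using finite_subset[OF order_trans[OF R(1) sub]] fin by simp
  have "d ` (A' \<times> B') \<subseteq> d ` (A' \<times> B' - R)"
  proof
    fix v assume "v \<in> d ` (A' \<times> B')"
    then obtain x where x: "x \<in> A' \<times> B'" "v = d x" by blast
    show "v \<in> d ` (A' \<times> B' - R)"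
    proof (cases "x \<in> R")
      case True
      then obtain y where "y \<in> A \<times> B - R" "d x = d y" using R(3) by blast
      then show ?thesis using sub x by auto
    qed (use x in auto)
  qed
  then have "card (d ` (A' \<times> B')) \<le> card (d ` (A' \<times> B' - R))"
    using fin by (intro card_mono) auto
  also have "\<dots> \<le> card (A' \<times> B' - R)" using fin by (intro card_image_le) auto
  also have "\<dots> = a * r - card R"
    using fR R(1) sub A'(3) B'(3) by (subst card_Diff_subset) (auto simp: card_cartesian_product)
  finally have "card (d ` (A' \<times> B')) \<le> a * r - card R" .
  moreover have "card R \<le> a * r"
    using card_mono[of "A' \<times> B'" R] fin R(1) sub A'(3) B'(3) by (auto simp: card_cartesian_product)
  ultimately have "card (d ` (A' \<times> B')) + r \<le> a * r" using R(2) by linarith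
  moreover have "a * r < card (d ` (A' \<times> B')) + r"
    using assms(1) A'(2,3) B'(2,3) unfolding repeat_bounded_def by blast
  ultimately show False by linarith
qed

text \<open>Over \<open>r\<close> leaves of the star, row \<open>x\<close> yields
  \<open>r - 1\<close> repetitions; equal colours at \<open>(x', y)\<close> and
  \<open>(x', y')\<close> would supply the missing one.\<close>

lemma star_leaves_rainbow:
  assumes "repeat_bounded d n a r" "a \<le> n" "r \<le> n" "2 \<le> a" "2 \<le> r"
    and "x < n" "x' < n" "x \<noteq> x'" "y < n" "y' < n" "y \<noteq> y'"
    and star: "d (x, y') = d (x, y)" "r \<le> card {z. z < n \<and> d (x, z) = d (x, y)}"
  shows "d (x', y) \<noteq> d (x', y')"
proof
  assume eq: "d (x', y) = d (x', y')"
  obtain Y where Y: "{y, y'} \<subseteq> Y" "Y \<subseteq> {z. z < n \<and> d (x, z) = d (x, y)}" "card Y = r"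
    using exists_subset_between[of "{y, y'}" r "{z. z < n \<and> d (x, z) = d (x, y)}"] assms by auto
  have fY: "finite Y" using Y(2) finite_subset by fastforce
  define R where "R = insert (x', y) ({x} \<times> (Y - {y}))"
  have "card ({x} \<times> (Y - {y})) = r - 1" using Y fY by (simp add: card_cartesian_product)
  then have "card R = r" using assms(5,8) fY unfolding R_def by (subst card_insert_disjoint) auto
  moreover have "\<exists>v\<in>{x, x'} \<times> Y - R. d u = d v" if "u \<in> R" for u
  proof (cases "u = (x', y)")
    case True
    have "(x', y') \<in> {x, x'} \<times> Y - R" using Y assms by (auto simp: R_def)
    then show ?thesis using True eq by blast
  next
    case False
    with that obtain z where "u = (x, z)" "z \<in> Y" by (auto simp: R_def)
    then have "d u = d (x, y)" using Y(2) by auto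
    moreover have "(x, y) \<in> {x, x'} \<times> Y - R" using Y assms by (auto simp: R_def)
    ultimately show ?thesis by blast
  qed
  moreover have "R \<subseteq> {x, x'} \<times> Y" using Y by (auto simp: R_def)
  ultimately show False
    using no_redundant_cells[OF assms(1-3), of "{x, x'}" Y R] Y assms by auto
qed

text \<open>
  By \<open>star_leaves_rainbow\<close> a pair of leaves \<open>(y, z)\<close> determines the centre of a large monochromatic star
  containing it.
\<close>

lemma card_large_stars_le:
  assumes "repeat_bounded d n a r" "a \<le> n" "r \<le> n" "2 \<le> a" "2 \<le> r" "r \<le> s"
  shows "card {(x, y). x < n \<and> y < n \<and> s \<le> card {z. z < n \<and> d (x, z) = d (x, y)}} * (s - 1) \<le> n * n"
proof -
  define L where "L = {(x, y). x < n \<and> y < n \<and> s \<le> card {z. z < n \<and> d (x, z) = d (x, y)}}"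
  define N where "N e = {z. z < n \<and> d (fst e, z) = d e \<and> z \<noteq> snd e}" for e
  have fL: "finite L" by (rule finite_subset[of _ "{..<n} \<times> {..<n}"]) (auto simp: L_def)
  have "card L * (s - 1) \<le> (\<Sum>e\<in>L. card (N e))"
  proof -
    have "s - 1 \<le> card (N e)" if "e \<in> L" for e
    proof -
      obtain x y where e: "e = (x, y)" by fastforce
      have "N e = {z. z < n \<and> d (x, z) = d (x, y)} - {y}" by (auto simp: N_def e)
      then have "card {z. z < n \<and> d (x, z) = d (x, y)} - 1 \<le> card (N e)"
        by (simp add: card_Diff_singleton_if)
      moreover have "s \<le> card {z. z < n \<and> d (x, z) = d (x, y)}" using that by (simp add: L_def e)
      ultimately show ?thesis by linarith
    qed
    then show ?thesis using sum_bounded_below[of L "s - 1" "\<lambda>e. card (N e)"] by simp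
  qed
  also have "\<dots> = card (SIGMA e:L. N e)" using fL by (simp add: N_def)
  also have "\<dots> \<le> card ({..<n} \<times> {..<n})"
  proof (rule card_inj_on_le[of "\<lambda>(e, z). (snd e, z)"])
    show "inj_on (\<lambda>(e, z). (snd e, z)) (SIGMA e:L. N e)"
    proof (rule inj_onI, clarsimp)
      fix x x' y z
      assume *: "(x, y) \<in> L" "z \<in> N (x, y)" "(x', y) \<in> L" "z \<in> N (x', y)"
      show "x = x'"
      proof (rule ccontr)
        assume "x \<noteq> x'"
        then have "d (x', y) \<noteq> d (x', z)"
          using * assms(6) by (intro star_leaves_rainbow[OF assms(1-5), of x]) (auto simp: L_def N_def)
        then show False using * by (simp add: N_def)
      qed
    qed
  qed (auto simp: L_def N_def)
  also have "\<dots> = n * n" by (simp add: card_cartesian_product)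
  finally show ?thesis by (simp add: L_def)
qed

lemma bounded_color_degree_edges:
  assumes d: "repeat_bounded d n a r" and d': "repeat_bounded (\<lambda>(i, j). d (j, i)) n a r"
    and "a \<le> n" "r \<le> n" "2 \<le> a" "2 \<le> r"
  shows "\<exists>E\<subseteq>{..<n} \<times> {..<n}. n * n \<le> 2 * card E \<and>
    (\<forall>x \<alpha>. card {y. (x, y) \<in> E \<and> d (x, y) = \<alpha>} \<le> r + 5) \<and>
    (\<forall>y \<alpha>. card {x. (x, y) \<in> E \<and> d (x, y) = \<alpha>} \<le> r + 5)"
proof -
  \<comment> \<open>At least \<open>r\<close>, as the star lemma asks, and with
    \<open>s - 1 \<ge> 4\<close>, so that large stars on each side use at most a quarter of all
    cells.\<close>
  define s where "s = r + 5"
  define L where "L = {(x, y). x < n \<and> y < n \<and> s \<le> card {z. z < n \<and> d (x, z) = d (x, y)}}"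
  define L' where "L' = {(y, x). y < n \<and> x < n \<and> s \<le> card {z. z < n \<and> d (z, y) = d (x, y)}}"
  define E where "E = {..<n} \<times> {..<n} - L - L'\<inverse>"
  have four: "4 * k \<le> n * n" if "k * (s - 1) \<le> n * n" for k
  proof -
    have "k * 4 \<le> k * (s - 1)" by (intro mult_le_mono2) (simp add: s_def)
    then show ?thesis using that by linarith
  qed
  have L: "4 * card L \<le> n * n"
    unfolding L_def using card_large_stars_le[OF d assms(3-6), of s] by (intro four) (simp add: s_def)
  have "4 * card L' \<le> n * n"
    unfolding L'_def using card_large_stars_le[OF d' assms(3-6), of s] by (intro four) (simp add: s_def)
  then have L': "4 * card (L'\<inverse>) \<le> n * n" by simp
  have "n * n = card ({..<n} \<times> {..<n})" by (simp add: card_cartesian_product)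
  also have "\<dots> \<le> card ((E \<union> L) \<union> L'\<inverse>)"
  proof (rule card_mono)
    have "L \<subseteq> {..<n} \<times> {..<n}" "L' \<subseteq> {..<n} \<times> {..<n}" by (auto simp: L_def L'_def)
    then have "finite L" "finite L'" by (auto intro: finite_subset)
    then show "finite (E \<union> L \<union> L'\<inverse>)" by (simp add: E_def)
  qed (auto simp: E_def)
  also have "\<dots> \<le> card E + card L + card (L'\<inverse>)"
    using card_Un_le[of "E \<union> L" "L'\<inverse>"] card_Un_le[of E L] by linarith
  finally have "n * n \<le> 2 * card E" using L L' by linarith
  moreover have "card {y. (x, y) \<in> E \<and> d (x, y) = \<alpha>} \<le> s" for x \<alpha>
  proof (cases "{y. (x, y) \<in> E \<and> d (x, y) = \<alpha>} = {}")
    case True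
    show ?thesis unfolding True by simp
  next
    case False
    then obtain y where y: "(x, y) \<in> E" "d (x, y) = \<alpha>" by blast
    have "card {y. (x, y) \<in> E \<and> d (x, y) = \<alpha>} \<le> card {z. z < n \<and> d (x, z) = d (x, y)}"
      using y by (intro card_mono) (auto simp: E_def)
    also have "\<dots> < s" using y by (auto simp: E_def L_def)
    finally show ?thesis by simp
  qed
  moreover have "card {x. (x, y) \<in> E \<and> d (x, y) = \<alpha>} \<le> s" for y \<alpha>
  proof (cases "{x. (x, y) \<in> E \<and> d (x, y) = \<alpha>} = {}")
    case True
    show ?thesis unfolding True by simp
  next
    case False
    then obtain x where x: "(x, y) \<in> E" "d (x, y) = \<alpha>" by blast
    have "card {x. (x, y) \<in> E \<and> d (x, y) = \<alpha>} \<le> card {z. z < n \<and> d (z, y) = d (x, y)}"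
      using x by (intro card_mono) (auto simp: E_def)
    also have "\<dots> < s" using x by (auto simp: E_def L'_def)
    finally show ?thesis by simp
  qed
  ultimately show ?thesis unfolding s_def by (intro exI[of _ E]) (auto simp: E_def)
qed

section \<open>The energy graph\<close>

lemma monochromatic_pairs_ge:
  fixes f :: "'a \<Rightarrow> nat"
  assumes "finite E" "f ` E \<subseteq> {..<k}" "k > 0"
  shows "(real (card E))\<^sup>2 / k \<le> card {(p, q). p \<in> E \<and> q \<in> E \<and> f p = f q}"
proof -
  define N where "N \<alpha> = {p \<in> E. f p = \<alpha>}" for \<alpha>
  have fN: "finite (N \<alpha>)" for \<alpha> using assms(1) by (simp add: N_def)
  have "E = (\<Union>\<alpha>\<in>{..<k}. N \<alpha>)" using assms(2) by (auto simp: N_def)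
  then have "card E = card (\<Union>\<alpha>\<in>{..<k}. N \<alpha>)" by (rule arg_cong)
  also have "\<dots> = (\<Sum>\<alpha><k. card (N \<alpha>))"
    by (rule card_UN_disjoint) (use fN in \<open>auto simp: N_def\<close>)
  finally have cE: "real (card E) = (\<Sum>\<alpha><k. real (card (N \<alpha>)))" by simp
  have "(real (card E))\<^sup>2 / k \<le> (\<Sum>\<alpha><k. (real (card (N \<alpha>)))\<^sup>2)"
    unfolding cE using assms(3) by (intro sum_squared_div_le) auto
  also have "\<dots> = (\<Sum>\<alpha><k. real (card (N \<alpha> \<times> N \<alpha>)))"
    by (simp add: card_cartesian_product power2_eq_square)
  also have "\<dots> = real (\<Sum>\<alpha><k. card (N \<alpha> \<times> N \<alpha>))" by simp
  also have "(\<Sum>\<alpha><k. card (N \<alpha> \<times> N \<alpha>)) = card (\<Union>\<alpha>\<in>{..<k}. N \<alpha> \<times> N \<alpha>)"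
    by (rule card_UN_disjoint[symmetric]) (use fN in \<open>auto simp: N_def\<close>)
  also have "(\<Union>\<alpha>\<in>{..<k}. N \<alpha> \<times> N \<alpha>) = {(p, q). p \<in> E \<and> q \<in> E \<and> f p = f q}"
    using assms(2) by (auto simp: N_def)
  finally show ?thesis .
qed

text \<open>Each neighbourhood is replaced by a greedily chosen conflict-free part, at the cost of a
  factor \<open>D\<close>.\<close>

lemma thin_neighbourhoods:
  fixes F :: "('a \<times> 'b) set"
  assumes "finite F" and sym: "\<And>x y. conf x y \<Longrightarrow> conf y x" and refl: "\<And>x. conf x x"
    and few: "\<And>a w. (a, w) \<in> F \<Longrightarrow> card {w'. (a, w') \<in> F \<and> conf w w'} \<le> D"
  shows "\<exists>F'\<subseteq>F. card F \<le> D * card F' \<and>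
    (\<forall>a w w'. (a, w) \<in> F' \<longrightarrow> (a, w') \<in> F' \<longrightarrow> w \<noteq> w' \<longrightarrow> \<not> conf w w')"
proof -
  have fin: "finite (F `` {a})" for a using assms(1) by (rule finite_Image)
  have "\<exists>I\<subseteq>F `` {a}. pairwise (\<lambda>x y. \<not> conf x y) I \<and> card (F `` {a}) \<le> D * card I" for a
  proof (rule independent_subset[OF fin])
    fix w assume "w \<in> F `` {a}"
    then have "card {w'. (a, w') \<in> F \<and> conf w w'} \<le> D" by (intro few) simp
    also have "{w'. (a, w') \<in> F \<and> conf w w'} = {w' \<in> F `` {a}. conf w w'}" by auto
    finally show "card {w' \<in> F `` {a}. conf w w'} \<le> D" .
  qed (use sym refl in auto)
  then obtain I where I: "\<And>a. I a \<subseteq> F `` {a}" "\<And>a. pairwise (\<lambda>x y. \<not> conf x y) (I a)"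
    "\<And>a. card (F `` {a}) \<le> D * card (I a)" by metis
  define A where "A = fst ` F"
  define F' where "F' = (SIGMA a:A. I a)"
  have fI: "finite (I a)" for a using I(1) fin finite_subset by blast
  have "F = (SIGMA a:A. F `` {a})" by (force simp: A_def)
  then have "card F = card (SIGMA a:A. F `` {a})" by (rule arg_cong)
  also have "\<dots> = (\<Sum>a\<in>A. card (F `` {a}))"
    using fin assms(1) by (intro card_SigmaI) (auto simp: A_def)
  also have "\<dots> \<le> (\<Sum>a\<in>A. D * card (I a))" by (intro sum_mono I(3))
  also have "\<dots> = D * card F'"
    unfolding F'_def using fI assms(1) by (simp add: A_def sum_distrib_left)
  finally have "card F \<le> D * card F'" .
  moreover have "F' \<subseteq> F" using I(1) by (auto simp: F'_def)
  ultimately show ?thesis using I(2) by (intro exI[of _ F']) (auto simp: F'_def pairwise_def)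
qed

definition shares :: "'a \<times> 'a \<Rightarrow> 'a \<times> 'a \<Rightarrow> bool" where
  "shares p q \<longleftrightarrow> {fst p, snd p} \<inter> {fst q, snd q} \<noteq> {}"

lemma shares_refl: "shares p p" by (simp add: shares_def)

lemma shares_sym: "shares p q \<Longrightarrow> shares q p" by (auto simp: shares_def)

text \<open>The source of the constant 2 in \<open>conflict_graph\<close>: the pairs in
  \<open>N\<close> are mutually disjoint, so each coordinate of \<open>w\<close> occurs in at most
  one of them.\<close>

lemma few_sharing:
  assumes "\<And>w w'. w \<in> N \<Longrightarrow> w' \<in> N \<Longrightarrow> w \<noteq> w' \<Longrightarrow> \<not> shares w w'"
  shows "card {w' \<in> N. shares w w'} \<le> 2"
proof -
  define g where "g w' = (if fst w \<in> {fst w', snd w'} then fst w else snd w)" for w'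
  have g: "g w' \<in> {fst w', snd w'}" if "shares w w'" for w'
    using that by (auto simp: g_def shares_def)
  have "inj_on g {w' \<in> N. shares w w'}"
  proof (rule inj_onI, clarsimp simp del: split_paired_All)
    fix a b c d assume *: "(a, b) \<in> N" "shares w (a, b)" "(c, d) \<in> N" "shares w (c, d)" "g (a, b) = g (c, d)"
    then have "shares (a, b) (c, d)" using g[of "(a, b)"] g[of "(c, d)"] by (auto simp: shares_def)
    then show "a = c \<and> b = d" using assms[of "(a, b)" "(c, d)"] * by auto
  qed
  then have "card {w' \<in> N. shares w w'} \<le> card {fst w, snd w}"
    by (rule card_inj_on_le) (auto simp: g_def)
  also have "\<dots> \<le> 2" by (simp add: card_insert_if)
  finally show ?thesis .
qed

text \<open>Only pairs of disjoint edges count, so each adjacency is a colour repetition at two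
  cells that differ in both coordinates. Both orders of a pair occur as vertices;
  \<open>shares\<close> treats them as conflicting.\<close>

definition energy :: "('a \<times> 'b \<Rightarrow> nat) \<Rightarrow> ('a \<times> 'b) set \<Rightarrow> (('a \<times> 'a) \<times> ('b \<times> 'b)) set" where
  "energy d E = {((x1, x2), (y1, y2)). (x1, y1) \<in> E \<and> (x2, y2) \<in> E \<and>
     d (x1, y1) = d (x2, y2) \<and> x1 \<noteq> x2 \<and> y1 \<noteq> y2}"

lemma energy_swap: "energy (d \<circ> prod.swap) (E\<inverse>) = (energy d E)\<inverse>"
  by (auto simp: energy_def)

lemma finite_energy: "finite E \<Longrightarrow> finite (energy d E)"
proof -
  assume "finite E"
  then have "finite ((\<lambda>((x1, y1), (x2, y2)). ((x1, x2), (y1, y2))) ` (E \<times> E))" by simp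
  moreover have "energy d E \<subseteq> (\<lambda>((x1, y1), (x2, y2)). ((x1, x2), (y1, y2))) ` (E \<times> E)"
    by (force simp: energy_def)
  ultimately show ?thesis by (rule finite_subset[rotated])
qed

text \<open>One entry of \<open>w'\<close> must be \<open>y1\<close> or \<open>y2\<close>. This
  fixes the colour of one edge, hence of the other, whose right end then has at most
  \<open>s\<close> possibilities; there are four such cases.\<close>

lemma energy_few_sharing:
  assumes "finite E" and deg: "\<And>x \<alpha>. card {y. (x, y) \<in> E \<and> d (x, y) = \<alpha>} \<le> s"
  shows "card {w'. (a, w') \<in> energy d E \<and> shares w w'} \<le> 4 * s"
proof -
  obtain x1 x2 y1 y2 where aw: "a = (x1, x2)" "w = (y1, y2)" by (metis surj_pair)
  define N where "N x \<alpha> = {y. (x, y) \<in> E \<and> d (x, y) = \<alpha>}" for x \<alpha>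
  have fN: "finite (N x \<alpha>)" for x \<alpha>
    by (rule finite_subset[of _ "snd ` E"]) (use assms(1) in \<open>force simp: N_def\<close>)+
  have cN: "card (N x \<alpha>) \<le> s" for x \<alpha> using deg by (simp add: N_def)
  have "{w'. (a, w') \<in> energy d E \<and> shares w w'} \<subseteq>
    (({y1} \<times> N x2 (d (x1, y1)) \<union> {y2} \<times> N x2 (d (x1, y2))) \<union> N x1 (d (x2, y1)) \<times> {y1}) \<union> N x1 (d (x2, y2)) \<times> {y2}"
    by (auto simp: energy_def shares_def aw N_def)
  then have "card {w'. (a, w') \<in> energy d E \<and> shares w w'} \<le> card
    ((({y1} \<times> N x2 (d (x1, y1)) \<union> {y2} \<times> N x2 (d (x1, y2))) \<union> N x1 (d (x2, y1)) \<times> {y1}) \<union> N x1 (d (x2, y2)) \<times> {y2})"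
    using fN by (intro card_mono) auto
  also have "\<dots> \<le> card ({y1} \<times> N x2 (d (x1, y1))) + card ({y2} \<times> N x2 (d (x1, y2)))
      + card (N x1 (d (x2, y1)) \<times> {y1}) + card (N x1 (d (x2, y2)) \<times> {y2})"
    by (intro order_trans[OF card_Un_le] add_right_mono order_refl)
  also have "\<dots> \<le> s + s + s + s"
    using cN by (intro add_mono) (simp_all add: card_cartesian_product)
  finally show ?thesis by simp
qed

text \<open>Cauchy-Schwarz over the colour classes counts all ordered monochromatic pairs of edges.
  Those with a common end, equal edges included, are missing from \<open>energy\<close>; each edge
  has at most \<open>s\<close> such partners at either end.\<close>

lemma card_energy_ge:
  fixes d :: "'a \<times> 'b \<Rightarrow> nat" and k s :: nat
  assumes "finite E" "d ` E \<subseteq> {..<k}" "k > 0"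
    and deg: "\<And>x \<alpha>. card {y. (x, y) \<in> E \<and> d (x, y) = \<alpha>} \<le> s"
    and deg': "\<And>y \<alpha>. card {x. (x, y) \<in> E \<and> d (x, y) = \<alpha>} \<le> s"
  shows "(real (card E))\<^sup>2 / k - 2 * real s * card E \<le> card (energy d E)"
proof -
  define P where "P = {(p, q). p \<in> E \<and> q \<in> E \<and> d p = d q}"
  define N where "N p = {y. (fst p, y) \<in> E \<and> d (fst p, y) = d p}" for p
  define N' where "N' p = {x. (x, snd p) \<in> E \<and> d (x, snd p) = d p}" for p
  define f where "f = (\<lambda>((x1, x2), (y1, y2)). ((x1, y1), (x2, y2)) :: ('a \<times> 'b) \<times> ('a \<times> 'b))"
  define g where "g = (\<lambda>(p, y). (p, (fst p, y)) :: ('a \<times> 'b) \<times> ('a \<times> 'b))"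
  define g' where "g' = (\<lambda>(p, x). (p, (x, snd p)) :: ('a \<times> 'b) \<times> ('a \<times> 'b))"
  have fN: "finite (N p)" for p
    by (rule finite_subset[of _ "snd ` E"]) (use assms(1) in \<open>force simp: N_def\<close>)+
  have fN': "finite (N' p)" for p
    by (rule finite_subset[of _ "fst ` E"]) (use assms(1) in \<open>force simp: N'_def\<close>)+
  have "card (SIGMA p:E. N p) = (\<Sum>p\<in>E. card (N p))" using fN assms(1) by simp
  also have "\<dots> \<le> card E * s"
    using sum_bounded_above[of E "\<lambda>p. card (N p)" s] deg by (simp add: N_def)
  finally have cN: "card (SIGMA p:E. N p) \<le> card E * s" .
  have "card (SIGMA p:E. N' p) = (\<Sum>p\<in>E. card (N' p))" using fN' assms(1) by simp
  also have "\<dots> \<le> card E * s"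
    using sum_bounded_above[of E "\<lambda>p. card (N' p)" s] deg' by (simp add: N'_def)
  finally have cN': "card (SIGMA p:E. N' p) \<le> card E * s" .
  have fin: "finite (energy d E)" "finite (SIGMA p:E. N p)" "finite (SIGMA p:E. N' p)"
    using finite_energy fN fN' assms(1) by auto
  have "P \<subseteq> (f ` energy d E \<union> g ` (SIGMA p:E. N p)) \<union> g' ` (SIGMA p:E. N' p)"
  proof
    fix pq assume "pq \<in> P"
    then obtain x1 y1 x2 y2 where pq: "pq = ((x1, y1), (x2, y2))"
      "(x1, y1) \<in> E" "(x2, y2) \<in> E" "d (x1, y1) = d (x2, y2)" by (auto simp: P_def)
    consider "x1 = x2" | "y1 = y2" | "x1 \<noteq> x2" "y1 \<noteq> y2" by blast
    then show "pq \<in> (f ` energy d E \<union> g ` (SIGMA p:E. N p)) \<union> g' ` (SIGMA p:E. N' p)"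
    proof cases
      case 1
      then have "((x1, y1), y2) \<in> (SIGMA p:E. N p)" "pq = g ((x1, y1), y2)"
        using pq by (auto simp: N_def g_def)
      then show ?thesis by blast
    next
      case 2
      then have "((x1, y1), x2) \<in> (SIGMA p:E. N' p)" "pq = g' ((x1, y1), x2)"
        using pq by (auto simp: N'_def g'_def)
      then show ?thesis by blast
    next
      case 3
      then have "((x1, x2), (y1, y2)) \<in> energy d E" "pq = f ((x1, x2), (y1, y2))"
        using pq by (auto simp: energy_def f_def)
      then show ?thesis by blast
    qed
  qed
  then have "card P \<le> card ((f ` energy d E \<union> g ` (SIGMA p:E. N p)) \<union> g' ` (SIGMA p:E. N' p))"
    using fin by (intro card_mono) auto
  also have "\<dots> \<le> card (f ` energy d E) + card (g ` (SIGMA p:E. N p)) + card (g' ` (SIGMA p:E. N' p))"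
    by (intro order_trans[OF card_Un_le] add_right_mono order_refl)
  also have "\<dots> \<le> card (energy d E) + card (SIGMA p:E. N p) + card (SIGMA p:E. N' p)"
    using fin by (intro add_mono card_image_le)
  also have "\<dots> \<le> card (energy d E) + card E * s + card E * s" using cN cN' by simp
  finally have "real (card P) \<le> real (card (energy d E) + card E * s + card E * s)" by (rule of_nat_mono)
  moreover have "(real (card E))\<^sup>2 / k \<le> card P"
    unfolding P_def by (rule monochromatic_pairs_ge[OF assms(1-3)])
  ultimately show ?thesis by (simp add: algebra_simps)
qed

text \<open>Thinning is applied to the right neighbours and then, on the converse relation, to the
  left ones; passing to a subset keeps the first property. Each round costs a factor
  \<open>4 * s\<close>.\<close>

lemma energy_conflict_graph:
  assumes "finite E" and deg: "\<And>x \<alpha>. card {y. (x, y) \<in> E \<and> d (x, y) = \<alpha>} \<le> s"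
    and deg': "\<And>y \<alpha>. card {x. (x, y) \<in> E \<and> d (x, y) = \<alpha>} \<le> s"
  obtains F where "F \<subseteq> energy d E" "card (energy d E) \<le> (4 * s) * (4 * s) * card F"
    "conflict_graph F shares"
    "\<And>p q w. (p, w) \<in> F \<Longrightarrow> (q, w) \<in> F \<Longrightarrow> p \<noteq> q \<Longrightarrow> \<not> shares p q"
proof -
  have fin: "finite (energy d E)" by (rule finite_energy[OF assms(1)])
  have "\<exists>F'\<subseteq>energy d E. card (energy d E) \<le> (4 * s) * card F' \<and>
    (\<forall>a w w'. (a, w) \<in> F' \<longrightarrow> (a, w') \<in> F' \<longrightarrow> w \<noteq> w' \<longrightarrow> \<not> shares w w')"
    using fin shares_sym shares_refl energy_few_sharing[OF assms(1) deg]
    by (rule thin_neighbourhoods)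
  then obtain F' where F': "F' \<subseteq> energy d E" "card (energy d E) \<le> (4 * s) * card F'"
    "\<And>a w w'. (a, w) \<in> F' \<Longrightarrow> (a, w') \<in> F' \<Longrightarrow> w \<noteq> w' \<Longrightarrow> \<not> shares w w'" by blast
  have fF': "finite F'" using F'(1) fin finite_subset by blast
  have few: "card {a'. (w, a') \<in> F'\<inverse> \<and> shares a a'} \<le> 4 * s" for a w
  proof -
    have "card {a'. (w, a') \<in> energy (d \<circ> prod.swap) (E\<inverse>) \<and> shares a a'} \<le> 4 * s"
      by (rule energy_few_sharing) (use assms(1) deg' in auto)
    moreover have "card {a'. (w, a') \<in> F'\<inverse> \<and> shares a a'}
        \<le> card {a'. (w, a') \<in> energy (d \<circ> prod.swap) (E\<inverse>) \<and> shares a a'}"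
    proof (rule card_mono)
      have "{a'. (w, a') \<in> energy (d \<circ> prod.swap) (E\<inverse>) \<and> shares a a'} \<subseteq> fst ` energy d E"
        unfolding energy_swap by force
      then show "finite {a'. (w, a') \<in> energy (d \<circ> prod.swap) (E\<inverse>) \<and> shares a a'}"
        using fin finite_subset by blast
    qed (use F'(1) in \<open>auto simp: energy_swap\<close>)
    ultimately show ?thesis by linarith
  qed
  have "\<exists>G\<subseteq>F'\<inverse>. card (F'\<inverse>) \<le> (4 * s) * card G \<and>
    (\<forall>w a a'. (w, a) \<in> G \<longrightarrow> (w, a') \<in> G \<longrightarrow> a \<noteq> a' \<longrightarrow> \<not> shares a a')"
    using _ shares_sym shares_refl few by (rule thin_neighbourhoods) (simp add: fF')
  then obtain G where G: "G \<subseteq> F'\<inverse>" "card (F'\<inverse>) \<le> (4 * s) * card G"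
    "\<And>w a a'. (w, a) \<in> G \<Longrightarrow> (w, a') \<in> G \<Longrightarrow> a \<noteq> a' \<Longrightarrow> \<not> shares a a'" by blast
  define F where "F = G\<inverse>"
  have FF': "F \<subseteq> F'" using G(1) by (auto simp: F_def)
  have "card (energy d E) \<le> (4 * s) * card F'" by (rule F'(2))
  also have "\<dots> \<le> (4 * s) * ((4 * s) * card F)"
    using G(2) by (intro mult_le_mono2) (simp add: F_def)
  finally have "card (energy d E) \<le> (4 * s) * (4 * s) * card F" by (simp add: mult.assoc)
  moreover have "conflict_graph F shares"
  proof
    show "finite F" using FF' fF' finite_subset by blast
    show "card {w'. (a, w') \<in> F \<and> shares w w'} \<le> 2" for a w
    proof -
      have "card {w' \<in> {w'. (a, w') \<in> F}. shares w w'} \<le> 2"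
        by (rule few_sharing) (use FF' F'(3) in blast)
      then show ?thesis by simp
    qed
    show "\<not> shares w w'" if "(a, w) \<in> F" "(a, w') \<in> F" "w \<noteq> w'" for a w w'
      using FF' F'(3) that by blast
  qed (simp_all add: shares_refl shares_sym)
  moreover have "\<not> shares p q" if "(p, w) \<in> F" "(q, w) \<in> F" "p \<noteq> q" for p q w
    using G(3) that by (auto simp: F_def)
  ultimately show ?thesis using FF' F'(1) by (intro that[of F]) auto
qed

section \<open>From subdivisions back to the colouring\<close>

text \<open>An incidence of a branch vertex \<open>p\<close> with a pair \<open>e\<close> gives
  equal colours at \<open>(fst p, fst (w e))\<close> and \<open>(snd p, snd (w e))\<close>. The
  first cells form \<open>R\<close> and the second avoid it, so \<open>R\<close> is redundant; it
  has one cell for each of the \<open>t * (t - 1)\<close> incidences.\<close>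

lemma no_energy_subdivision:
  assumes rb: "repeat_bounded d n (2 * t) (t * (t - 1))"
    and n: "2 * t \<le> n" "t * (t - 1) \<le> n" and t: "t \<ge> 2"
    and E: "E \<subseteq> {..<n} \<times> {..<n}" and F: "F \<subseteq> energy d E"
    and cg: "conflict_graph F shares"
    and left: "\<And>p q w. (p, w) \<in> F \<Longrightarrow> (q, w) \<in> F \<Longrightarrow> p \<noteq> q \<Longrightarrow> \<not> shares p q"
  shows "\<not> conflict_graph.subdivision F shares t Q w"
proof
  interpret conflict_graph F shares by (rule cg)
  assume sub: "subdivision t Q w"
  define P where "P = {e. e \<subseteq> Q \<and> card e = 2}"
  define r where "r = t * (t - 1)"
  have cQ: "card Q = t" using sub by (simp add: subdivision_def)
  have fQ: "finite Q" using cQ t card.infinite by fastforce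
  have P: "finite P" "card P = t choose 2"
    using n_subsets[OF fQ, of 2] fQ cQ by (auto simp: P_def)
  have r: "2 * card P = r" using P t by (simp add: choose_two r_def)
  have adj: "(p, w e) \<in> F" if "e \<in> P" "p \<in> e" for p e
    using sub that by (auto simp: subdivision_def P_def nb_def)
  have sep: "e = e'" if "e \<in> P" "e' \<in> P" "shares (w e) (w e')" for e e'
    using sub that unfolding subdivision_def P_def by blast
  have sepQ: "p = q" if "p \<in> Q" "q \<in> Q" "shares p q" for p q
  proof (rule ccontr)
    assume "p \<noteq> q"
    then have "{p, q} \<in> P" using that by (simp add: P_def)
    then show False using adj[of "{p, q}"] left that(3) \<open>p \<noteq> q\<close> by blast
  qed
  have PQ: "p \<in> Q" if "e \<in> P" "p \<in> e" for e p using that by (auto simp: P_def)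
  have en: "(fst p, fst (w e)) \<in> E" "(snd p, snd (w e)) \<in> E"
    "d (fst p, fst (w e)) = d (snd p, snd (w e))" "fst p \<noteq> snd p"
    if "e \<in> P" "p \<in> e" for p e
    using adj[OF that] F by (auto simp: energy_def)
  have Q_covered: "\<exists>e\<in>P. p \<in> e" if "p \<in> Q" for p
  proof -
    have "Q \<noteq> {p}" using cQ t by auto
    then obtain q where "q \<in> Q" "q \<noteq> p" using \<open>p \<in> Q\<close> by blast
    then have "{p, q} \<in> P" using that by (simp add: P_def)
    then show ?thesis by blast
  qed
  define A where "A = fst ` Q \<union> snd ` Q"
  define B where "B = (fst \<circ> w) ` P \<union> (snd \<circ> w) ` P"
  define cell where "cell = (\<lambda>(e, p :: nat \<times> nat). (fst p, fst (w e)))"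
  define R where "R = cell ` (SIGMA e:P. e)"
  have "card A \<le> card Q + card Q"
    unfolding A_def using fQ by (intro order_trans[OF card_Un_le] add_mono card_image_le)
  then have cA: "card A \<le> 2 * t" using cQ by simp
  have "card B \<le> card P + card P"
    unfolding B_def using P by (intro order_trans[OF card_Un_le] add_mono card_image_le)
  then have cB: "card B \<le> r" using r by simp
  have AB: "A \<subseteq> {..<n}" "B \<subseteq> {..<n}"
  proof -
    show "A \<subseteq> {..<n}"
    proof
      fix x assume "x \<in> A"
      then obtain p where p: "p \<in> Q" "x = fst p \<or> x = snd p" by (auto simp: A_def)
      then obtain e where "e \<in> P" "p \<in> e" using Q_covered by blast
      then show "x \<in> {..<n}" using en[of e p] E p by auto
    qed
    show "B \<subseteq> {..<n}"
    proof
      fix y assume "y \<in> B"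
      then obtain e where e: "e \<in> P" "y = fst (w e) \<or> y = snd (w e)" by (auto simp: B_def)
      then have "e \<noteq> {}" by (auto simp: P_def)
      then obtain p where "p \<in> e" by blast
      then show "y \<in> {..<n}" using en[of e p] E e by auto
    qed
  qed
  have "inj_on cell (SIGMA e:P. e)"
  proof (rule inj_onI)
    fix u v assume uv: "u \<in> (SIGMA e:P. e)" "v \<in> (SIGMA e:P. e)" "cell u = cell v"
    obtain e p where u: "u = (e, p)" by (cases u)
    obtain e' p' where v: "v = (e', p')" by (cases v)
    have *: "e \<in> P" "p \<in> e" "e' \<in> P" "p' \<in> e'" "fst p = fst p'" "fst (w e) = fst (w e')"
      using uv by (auto simp: u v cell_def)
    then have "shares p p'" "shares (w e) (w e')" by (auto simp: shares_def)
    then show "u = v" using sep sepQ PQ * unfolding u v by blast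
  qed
  then have "card R = card (SIGMA e:P. e)" unfolding R_def by (rule card_image)
  also have "\<dots> = (\<Sum>e\<in>P. card e)"
    using P fQ by (intro card_SigmaI) (auto simp: P_def intro: finite_subset)
  also have "\<dots> = r" using r by (simp add: P_def)
  finally have cR: "card R = r" .
  have RAB: "R \<subseteq> A \<times> B" using PQ by (auto simp: R_def cell_def A_def B_def)
  have "\<exists>v\<in>A \<times> B - R. d u = d v" if "u \<in> R" for u
  proof -
    obtain e p where ep: "e \<in> P" "p \<in> e" "u = (fst p, fst (w e))"
      using \<open>u \<in> R\<close> unfolding R_def cell_def by force
    \<comment> \<open>Disjointness of branch vertices handles \<open>p' \<noteq> p\<close>; for
      \<open>p' = p\<close> the condition \<open>x1 \<noteq> x2\<close> in \<open>energy\<close> is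
      needed.\<close>
    have ne: "snd p \<noteq> fst p'" if "p' \<in> Q" for p'
    proof
      assume "snd p = fst p'"
      then have "shares p p'" by (simp add: shares_def)
      then have "p = p'" using sepQ that PQ ep by blast
      then show False using \<open>snd p = fst p'\<close> en(4)[OF ep(1,2)] by simp
    qed
    have "(snd p, snd (w e)) \<notin> R"
    proof
      assume "(snd p, snd (w e)) \<in> R"
      then obtain e' p' where "e' \<in> P" "p' \<in> e'" "snd p = fst p'"
        unfolding R_def cell_def by force
      then show False using ne PQ by blast
    qed
    moreover have "(snd p, snd (w e)) \<in> A \<times> B" using ep PQ by (auto simp: A_def B_def)
    ultimately show ?thesis using en(3)[OF ep(1,2)] ep(3) by blast
  qed
  then show False
    using no_redundant_cells[OF rb n AB(1) cA AB(2) cB[unfolded r_def] RAB] cR by (simp add: r_def)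
qed

text \<open>With fewer colours the energy graph would be dense enough for a subdivision.
  \<open>8 * real s * c \<le> 1\<close> keeps the loss in \<open>card_energy_ge\<close> to half of
  the main term. The constant 128 is \<open>4 * 2 * 16\<close>: 4 since \<open>card E\<close> is
  only at least half of \<open>n\<^sup>2\<close> and gets squared, 2 from that loss, and 16 from the
  two thinnings.\<close>

lemma colors_ge:
  fixes t :: nat and n k :: nat
  assumes t: "t \<ge> 2" and C: "C > 0"
    and sub: "\<forall>(F :: ((nat \<times> nat) \<times> (nat \<times> nat)) set) conf A B. conflict_graph F conf \<longrightarrow> F \<subseteq> A \<times> B \<longrightarrow>
      finite A \<longrightarrow> finite B \<longrightarrow> card A = card B \<longrightarrow>
      C * real (card A) powr (1 + (real t - 2) / (2 * real t - 3)) < card F \<longrightarrow>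
      (\<exists>Q w. conflict_graph.subdivision F conf t Q w)"
    and rb: "repeat_bounded d n (2 * t) (t * (t - 1))"
    and rb': "repeat_bounded (\<lambda>(i, j). d (j, i)) n (2 * t) (t * (t - 1))"
    and n: "2 * t \<le> n" "t * (t - 1) \<le> n" and k: "d ` ({..<n} \<times> {..<n}) \<subseteq> {..<k}"
    and s: "s = t * (t - 1) + 5" and c: "c > 0" "8 * real s * c \<le> 1" "128 * (real s)\<^sup>2 * C * c \<le> 1"
  shows "c * real n powr (1 + 1 / (2 * real t - 3)) \<le> k"
proof (rule ccontr)
  assume contra: "\<not> ?thesis"
  define p where "p = 1 + 1 / (2 * real t - 3)"
  have kp: "real k < c * real n powr p" using contra by (simp add: p_def)
  \<comment> \<open>The factor 2 converts a power of the part size \<open>n\<^sup>2\<close> into a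
    power of \<open>n\<close>; \<open>4 - p\<close> is what remains of \<open>n powr 4\<close> after
    division by the number of colours.\<close>
  have p: "p \<le> 2" "2 * (1 + (real t - 2) / (2 * real t - 3)) = 4 - p"
    using t by (auto simp: p_def field_simps)
  have n1: "real n \<ge> 1" using n t by simp
  have r2: "2 \<le> t * (t - 1)"
  proof -
    have "2 * 1 \<le> t * (t - 1)" using t by (intro mult_le_mono) auto
    then show ?thesis by simp
  qed
  have t2: "2 \<le> 2 * t" using t by simp
  obtain E where E: "E \<subseteq> {..<n} \<times> {..<n}" "n * n \<le> 2 * card E"
    and deg: "\<And>x \<alpha>. card {y. (x, y) \<in> E \<and> d (x, y) = \<alpha>} \<le> s"
    and deg': "\<And>y \<alpha>. card {x. (x, y) \<in> E \<and> d (x, y) = \<alpha>} \<le> s"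
    using bounded_color_degree_edges[OF rb rb' n t2 r2] unfolding s by blast
  have fE: "finite E" using E(1) finite_subset by blast
  obtain F where F: "F \<subseteq> energy d E" "card (energy d E) \<le> (4 * s) * (4 * s) * card F"
    and cg: "conflict_graph F shares"
    and left: "\<And>p q w. (p, w) \<in> F \<Longrightarrow> (q, w) \<in> F \<Longrightarrow> p \<noteq> q \<Longrightarrow> \<not> shares p q"
    using energy_conflict_graph[OF fE deg deg'] by metis
  have "real (n * n) \<le> real (2 * card E)" using E(2) by (rule of_nat_mono)
  then have e2: "(real n)\<^sup>2 \<le> 2 * real (card E)" by (simp add: power2_eq_square)
  have dE: "d ` E \<subseteq> {..<k}" using k E(1) by blast
  have "E \<noteq> {}" using E(2) n1 by auto
  then have k0: "k > 0" using dE by auto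
  have "s > 0" using s by simp
  then have s0: "real s > 0" by simp
  have lower: "(real (card E))\<^sup>2 / k - 2 * real s * card E \<le> card (energy d E)"
    by (rule card_energy_ge[OF fE dE k0 deg deg'])
  have "real n powr p \<le> (real n)\<^sup>2"
    using powr_mono[OF p(1) n1] n1 by (simp add: powr_numeral)
  then have "c * real n powr p \<le> c * (real n)\<^sup>2" using c(1) by (intro mult_left_mono) auto
  with kp have "8 * real s * k \<le> 8 * real s * (c * (real n)\<^sup>2)" using s0 by (intro mult_left_mono) auto
  also have "\<dots> = (8 * real s * c) * (real n)\<^sup>2" by simp
  also have "\<dots> \<le> 1 * (real n)\<^sup>2" using c(2) by (intro mult_right_mono) auto
  also have "\<dots> \<le> 2 * real (card E)" using e2 by simp
  finally have "4 * real s * real k \<le> real (card E)" by (simp add: mult_ac)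
  then have "(4 * real s * real k) * real (card E) \<le> real (card E) * real (card E)" by (intro mult_right_mono) auto
  then have "2 * real s * card E \<le> (real (card E))\<^sup>2 / k / 2"
    using k0 by (simp add: field_simps power2_eq_square)
  with lower have "(real (card E))\<^sup>2 / k / 2 \<le> card (energy d E)" by linarith
  also have "\<dots> \<le> real ((4 * s) * (4 * s) * card F)" using F(2) by (rule of_nat_mono)
  finally have "(real (card E))\<^sup>2 \<le> 32 * (real s)\<^sup>2 * k * card F"
    using k0 by (simp add: field_simps power2_eq_square)
  moreover have "((real n)\<^sup>2)\<^sup>2 \<le> (2 * real (card E))\<^sup>2" using e2 by (rule power_mono) simp
  ultimately have "((real n)\<^sup>2)\<^sup>2 \<le> 128 * (real s)\<^sup>2 * k * card F" by (simp add: power_mult_distrib)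
  then have n4: "real n powr 4 \<le> 128 * (real s)\<^sup>2 * k * card F"
    using n1 by (simp add: powr_numeral)
  have "C * real n powr (4 - p) * (128 * (real s)\<^sup>2 * k) < C * real n powr (4 - p) * (128 * (real s)\<^sup>2 * (c * real n powr p))"
    using kp C s0 n1 by (intro mult_strict_left_mono) auto
  also have "\<dots> = (128 * (real s)\<^sup>2 * C * c) * (real n powr (4 - p) * real n powr p)" by simp
  also have "real n powr (4 - p) * real n powr p = real n powr 4" by (simp flip: powr_add)
  also have "(128 * (real s)\<^sup>2 * C * c) * real n powr 4 \<le> 1 * real n powr 4"
    using c(3) by (intro mult_right_mono) auto
  also have "\<dots> \<le> card F * (128 * (real s)\<^sup>2 * k)" using n4 by (simp add: mult_ac)
  finally have "C * real n powr (4 - p) < card F"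
    using k0 s0 by (simp add: mult_less_cancel_right)
  moreover have "real (n * n) powr (1 + (real t - 2) / (2 * real t - 3)) = real n powr (4 - p)"
    using n1 by (simp add: powr_mult p(2)[symmetric] flip: powr_add)
  ultimately have "C * real (card ({..<n} \<times> {..<n})) powr (1 + (real t - 2) / (2 * real t - 3)) < card F"
    by (simp add: card_cartesian_product)
  moreover have "F \<subseteq> ({..<n} \<times> {..<n}) \<times> ({..<n} \<times> {..<n})"
    using F(1) E(1) by (force simp: energy_def)
  ultimately obtain Q w where "conflict_graph.subdivision F shares t Q w"
    using sub[rule_format, OF cg, of "{..<n} \<times> {..<n}" "{..<n} \<times> {..<n}"] by auto
  moreover have "\<not> conflict_graph.subdivision F shares t Q w"
    by (rule no_energy_subdivision[OF rb n t E(1) F(1) cg]) (use left in blast)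
  ultimately show False by contradiction
qed

theorem theorem1p9:
  fixes t :: nat
  assumes "t \<ge> 2"
  shows "(\<lambda>n::nat. real (ramsey_num (complete_bipartite n n)
                        (complete_bipartite (2 * t) (t * (t - 1)))
                        (2 * t\<^sup>2 * (t - 1) - t * (t - 1) + 1)))
         \<in> \<Omega>(\<lambda>n. real n powr (1 + 1 / (2 * real t - 3)))"
proof -
  define r where "r = t * (t - 1)"
  define q where "q = 2 * t\<^sup>2 * (t - 1) - t * (t - 1) + 1"
  define s where "s = r + 5"
  \<comment> \<open>Of the \<open>2 * t * r\<close> edges at most \<open>r - 1\<close> may repeat a
    colour; \<open>rle\<close> makes the truncated subtraction exact.\<close>
  have q: "q = 2 * t * r - r + 1" by (simp add: q_def r_def power2_eq_square mult.assoc)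
  have r0: "1 \<le> r" using assms by (simp add: r_def)
  have rle: "r \<le> 2 * t * r" using assms by simp
  have qle: "q \<le> 2 * t * r"
  proof -
    have "2 * r \<le> 2 * t * r" using assms by simp
    then show ?thesis using r0 q by linarith
  qed
  obtain C where C: "C > 0"
    and sub: "\<forall>(F :: ((nat \<times> nat) \<times> (nat \<times> nat)) set) conf A B. conflict_graph F conf \<longrightarrow> F \<subseteq> A \<times> B \<longrightarrow>
      finite A \<longrightarrow> finite B \<longrightarrow> card A = card B \<longrightarrow>
      C * real (card A) powr (1 + (real t - 2) / (2 * real t - 3)) < card F \<longrightarrow>
      (\<exists>Q w. conflict_graph.subdivision F conf t Q w)"
    using conflict_graph_subdivision[OF assms, where 'a = "nat \<times> nat" and 'b = "nat \<times> nat"] by blast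
  define c where "c = min (1 / (8 * real s)) (1 / (128 * (real s)\<^sup>2 * C))"
  have s0: "real s > 0" by (simp add: s_def)
  have c: "c > 0" using s0 C by (simp add: c_def)
  have c1: "8 * real s * c \<le> 1"
  proof -
    have "8 * real s * c \<le> 8 * real s * (1 / (8 * real s))"
      using s0 by (intro mult_left_mono) (auto simp: c_def)
    then show ?thesis using s0 by simp
  qed
  have c2: "128 * (real s)\<^sup>2 * C * c \<le> 1"
  proof -
    have "128 * (real s)\<^sup>2 * C * c \<le> 128 * (real s)\<^sup>2 * C * (1 / (128 * (real s)\<^sup>2 * C))"
      using s0 C by (intro mult_left_mono) (auto simp: c_def)
    then show ?thesis using s0 C by simp
  qed
  have bound: "c * real n powr (1 + 1 / (2 * real t - 3))
      \<le> real (ramsey_num (complete_bipartite n n) (complete_bipartite (2 * t) r) q)"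
    if n: "2 * t + r \<le> n" for n
  proof -
    let ?k = "ramsey_num (complete_bipartite n n) (complete_bipartite (2 * t) r) q"
    have "finite (edges (complete_bipartite n n))"
    proof (rule ccontr)
      assume "infinite (edges (complete_bipartite n n))"
      then have "card (edges (complete_bipartite n n)) = 0" by simp
      then show False using n r0 by (simp add: card_edges_complete_bipartite)
    qed
    then obtain col where col: "col \<in> edges (complete_bipartite n n) \<rightarrow> {..<?k}"
      and Hq: "Hq_coloring (complete_bipartite n n) (complete_bipartite (2 * t) r) q col"
      using ramsey_num_attained[OF _ simple_graph_complete_bipartite, of _ q "2 * t" r] qle
      by (auto simp: card_edges_complete_bipartite)
    define d where "d = (\<lambda>(i, j). col {Inl i, Inr j})"
    have qr: "2 * t * r < x + r" if "q \<le> x" for x using that q rle by linarith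
    have "repeat_bounded d n (2 * t) r"
      unfolding repeat_bounded_def d_def
      using complete_bipartite_subgraph_colors(1)[OF Hq] qr by blast
    moreover have "repeat_bounded (\<lambda>(i, j). d (j, i)) n (2 * t) r"
      unfolding repeat_bounded_def d_def prod.case
      using complete_bipartite_subgraph_colors(2)[OF Hq] qr by blast
    moreover have "d ` ({..<n} \<times> {..<n}) \<subseteq> {..<?k}"
      using col by (force simp: d_def complete_bipartite_def)
    ultimately show ?thesis
      using colors_ge[OF assms C sub, of d n ?k s c] n c c1 c2 by (simp add: r_def s_def)
  qed
  show ?thesis
    unfolding q_def[symmetric] unfolding r_def[symmetric]
  proof (rule landau_omega.bigI[OF c])
    show "\<forall>\<^sub>F n in at_top. c * norm (real n powr (1 + 1 / (2 * real t - 3)))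
        \<le> norm (real (ramsey_num (complete_bipartite n n) (complete_bipartite (2 * t) r) q))"
      using bound by (intro eventually_at_top_linorderI[of "2 * t + r"]) simp
  qed
qed

end
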